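(* Let $(\mathcal A,G,\alpha)$ be a $C^*$-action and $(\mathcal L,\eta)$ be a host algebra for $G$. If $(\pi,U)\in\mathrm{Rep}_{\mathcal L}(\alpha,\mathcal H)$ satisfies $\pi(\mathcal A)U_{\mathcal L}(\mathcal L)\subseteq\mathcal K(\mathcal H)$ (the compact operators on $\mathcal H$), then $(\pi,U)$ is a cross representation for $(\alpha,\mathcal L)$. This holds in particular if $U_{\mathcal L}(\mathcal L)\subseteq\mathcal K(\mathcal H)$.
   Context: $M(\mathcal B)$ denotes the multiplier algebra of a $C^*$-algebra $\mathcal B$. $\mathrm{Rep}(\mathcal B,\mathcal H)$ is the set of non-degenerate representations of $\mathcal B$ on the complex Hilbert space $\mathcal H$; each such $\pi$ extends uniquely to a representation $\tilde\pi$ of $M(\mathcal B)$ on $\mathcal H$. $\mathrm{Rep}(G,\mathcal H)$ is the set of strong-operator continuous unitary representations of $G$ on $\mathcal H$. For sets $X,Y$ of operators, $XY=\{xy:x\in X,y\in Y\}$. A host algebra for a topological group $G$ is a pair $(\mathcal L,\eta)$, with $\mathcal L$ a $C^*$-algebra and $\eta:G\to \mathrm U(M(\mathcal L))$ a group homomorphism, such that (H1) for each non-degenerate representation $\pi$ of $\mathcal L$, $\tilde\pi\circ\eta$ is a continuous unitary representation of $G$; (H2) for each $\mathcal H$ the map $\eta^*:\mathrm{Rep}(\mathcal L,\mathcal H)\to\mathrm{Rep}(G,\mathcal H)$, $\pi\mapsto\tilde\pi\circ\eta$, is injective. Elements of the range of $\eta^*$ are called $\mathcal L$-representations of $G$;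 for such $U$, $U_{\mathcal L}:=(\eta^* )^{-1}(U)\in\mathrm{Rep}(\mathcal L,\mathcal H)$. A $C^*$-action $(\mathcal A,G,\alpha)$ is a $C^*$-algebra $\mathcal A$, a topological group $G$ and a group homomorphism $\alpha:G\to\mathrm{Aut}(\mathcal A)$ (no continuity assumed). $\mathrm{Rep}_{\mathcal L}(\alpha,\mathcal H)$ is the set of pairs $(\pi,U)$ with $\pi\in\mathrm{Rep}(\mathcal A,\mathcal H)$, $U$ an $\mathcal L$-representation of $G$ on $\mathcal H$, and $U(g)\pi(A)U(g)^*=\pi(\alpha_g(A))$ for all $g\in G$, $A\in\mathcal A$. $(\pi,U)\in\mathrm{Rep}_{\mathcal L}(\alpha,\mathcal H)$ is a cross representation for $(\alpha,\mathcal L)$ if $\pi(\mathcal A)U_{\mathcal L}(\mathcal L)\subseteq U_{\mathcal L}(\mathcal L)B(\mathcal H)$; equivalently, for some (equivalently every) approximate identity $(E_j)$ of $\mathcal L$, $\|U_{\mathcal L}(E_j)\pi(A)U_{\mathcal L}(L)-\pi(A)U_{\mathcal L}(L)\|\to0$ for all $A\in\mathcal A$, $L\in\mathcal L$. *)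

theory Defs
  imports "HOL-Analysis.Analysis"
begin

section \<open>Complex vector spaces, star-algebras, C*-algebras, Hilbert spaces\<close>

class complex_vector = real_vector +
  fixes scaleC :: "complex \<Rightarrow> 'a \<Rightarrow> 'a"
  assumes scaleC_add_right: "scaleC c (x + y) = scaleC c x + scaleC c y"
    and scaleC_add_left: "scaleC (c + d) x = scaleC c x + scaleC d x"
    and scaleC_scaleC: "scaleC c (scaleC d x) = scaleC (c * d) x"
    and scaleC_one: "scaleC 1 x = x"
    and scaleR_scaleC: "scaleR r x = scaleC (complex_of_real r) x"

global_interpretation complex_vector:
  vector_space "scaleC :: complex \<Rightarrow> 'a \<Rightarrow> 'a::complex_vector"
  by standard (simp_all add: scaleC_add_right scaleC_add_left scaleC_scaleC scaleC_one)

class complex_normed_vector = complex_vector + real_normed_vector +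
  assumes norm_scaleC: "norm (scaleC c x) = cmod c * norm x"

class star_algebra = complex_vector + ring +
  fixes star :: "'a \<Rightarrow> 'a"
  assumes mult_scaleC_left: "scaleC c x * y = scaleC c (x * y)"
    and mult_scaleC_right: "x * scaleC c y = scaleC c (x * y)"
    and star_star: "star (star x) = x"
    and star_add: "star (x + y) = star x + star y"
    and star_scaleC: "star (scaleC c x) = scaleC (cnj c) (star x)"
    and star_mult: "star (x * y) = star y * star x"

text \<open>C*-algebras need not be unital and may be zero.\<close>

class cstar_algebra = star_algebra + complex_normed_vector + real_normed_algebra + banach +
  assumes cstar_identity: "norm (star x * x) = (norm x)\<^sup>2"

definition unitary_element :: "'a::{star_algebra, monoid_mult} \<Rightarrow> bool" where
  "unitary_element u \<longleftrightarrow> star u * u = 1 \<and> u * star u = 1"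

text \<open>The inner product is conjugate-linear in the first argument.\<close>

class complex_hilbert_space = complex_normed_vector + banach +
  fixes cinner :: "'a \<Rightarrow> 'a \<Rightarrow> complex"
  assumes cinner_commute: "cinner x y = cnj (cinner y x)"
    and cinner_add_right: "cinner x (y + z) = cinner x y + cinner x z"
    and cinner_scaleC_right: "cinner x (scaleC c y) = c * cinner x y"
    and cinner_self: "cinner x x = complex_of_real ((norm x)\<^sup>2)"


section \<open>The multiplier algebra\<close>

text \<open>
  \<open>M(B)\<close> is the algebra of double centralizers of \<open>B\<close>: pairs \<open>(S, T)\<close> of maps with
  \<open>a (S b) = (T a) b\<close>.  Linearity, boundedness and the module identities
  \<open>S (a b) = (S a) b\<close>, \<open>T (a b) = a (T b)\<close> are consequences, since a C*-algebra is
  faithful as a left and as a right module over itself.  Only the unital star-algebra structure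
  is introduced, because unitary elements and representations do not refer to the norm.
\<close>

lemma cstar_eq_zero_iff: "star x * x = 0 \<longleftrightarrow> x = 0" for x :: "'a::cstar_algebra"
  by (metis cstar_identity mult_zero_right norm_eq_zero power_eq_0_iff zero_neq_numeral)

lemma cstar_faithful_left: "x = y" if "\<And>a. a * x = a * y" for x y :: "'a::cstar_algebra"
  using that cstar_eq_zero_iff[of "x - y"] by (simp add: right_diff_distrib)

lemma cstar_faithful_right: "x = y" if "\<And>a. x * a = y * a" for x y :: "'a::cstar_algebra"
proof -
  have "star x = star y"
    by (rule cstar_faithful_left) (metis star_mult star_star that)
  then show ?thesis by (metis star_star)
qed

definition double_centralizer :: "('a::cstar_algebra \<Rightarrow> 'a) \<times> ('a \<Rightarrow> 'a) \<Rightarrow> bool" where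
  "double_centralizer m \<longleftrightarrow> (\<forall>a b. a * fst m b = snd m a * b)"

typedef (overloaded) 'a multiplier = "{m :: ('a::cstar_algebra \<Rightarrow> 'a) \<times> ('a \<Rightarrow> 'a). double_centralizer m}"
  by (rule exI[of _ "(\<lambda>b. b, \<lambda>a. a)"]) (simp add: double_centralizer_def)

definition lmult :: "'a::cstar_algebra multiplier \<Rightarrow> 'a \<Rightarrow> 'a" where
  "lmult m = fst (Rep_multiplier m)"

definition rmult :: "'a::cstar_algebra multiplier \<Rightarrow> 'a \<Rightarrow> 'a" where
  "rmult m = snd (Rep_multiplier m)"

definition mk_multiplier ::
    "('a::cstar_algebra \<Rightarrow> 'a) \<Rightarrow> ('a \<Rightarrow> 'a) \<Rightarrow> 'a multiplier" where
  "mk_multiplier S T = Abs_multiplier (S, T)"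

lemma multiplier_centralizer: "a * lmult m b = rmult m a * b"
  using Rep_multiplier[of m] by (simp add: lmult_def rmult_def double_centralizer_def)

lemma lmult_mk: "lmult (mk_multiplier S T) = S" if "\<And>a b. a * S b = T a * b"
  using that by (simp add: lmult_def mk_multiplier_def Abs_multiplier_inverse double_centralizer_def)

lemma rmult_mk: "rmult (mk_multiplier S T) = T" if "\<And>a b. a * S b = T a * b"
  using that by (simp add: rmult_def mk_multiplier_def Abs_multiplier_inverse double_centralizer_def)

lemma multiplier_eqI: "m = n" if "\<And>b. lmult m b = lmult n b" for m n :: "'a::cstar_algebra multiplier"
proof -
  have "rmult m a = rmult n a" for a
    by (rule cstar_faithful_right) (simp add: that flip: multiplier_centralizer)
  then have "Rep_multiplier m = Rep_multiplier n"
    using that by (simp add: prod_eq_iff lmult_def rmult_def fun_eq_iff)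
  then show ?thesis by (simp add: Rep_multiplier_inject)
qed

lemma lmult_add: "lmult m (a + b) = lmult m a + lmult m b"
  by (rule cstar_faithful_left) (simp add: multiplier_centralizer distrib_left)

lemma lmult_scaleC: "lmult m (scaleC c a) = scaleC c (lmult m a)"
  by (rule cstar_faithful_left) (simp add: multiplier_centralizer mult_scaleC_right)

instantiation multiplier :: (cstar_algebra) "{star_algebra, monoid_mult}"
begin

definition zero_multiplier :: "'a multiplier" where
  "0 = mk_multiplier (\<lambda>b. 0) (\<lambda>a. 0)"

definition plus_multiplier :: "'a multiplier \<Rightarrow> 'a multiplier \<Rightarrow> 'a multiplier" where
  "m + n = mk_multiplier (\<lambda>b. lmult m b + lmult n b) (\<lambda>a. rmult m a + rmult n a)"

definition uminus_multiplier :: "'a multiplier \<Rightarrow> 'a multiplier" where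
  "- m = mk_multiplier (\<lambda>b. - lmult m b) (\<lambda>a. - rmult m a)"

definition minus_multiplier :: "'a multiplier \<Rightarrow> 'a multiplier \<Rightarrow> 'a multiplier" where
  "m - n = mk_multiplier (\<lambda>b. lmult m b - lmult n b) (\<lambda>a. rmult m a - rmult n a)"

definition scaleC_multiplier :: "complex \<Rightarrow> 'a multiplier \<Rightarrow> 'a multiplier" where
  "scaleC c m = mk_multiplier (\<lambda>b. scaleC c (lmult m b)) (\<lambda>a. scaleC c (rmult m a))"

definition scaleR_multiplier :: "real \<Rightarrow> 'a multiplier \<Rightarrow> 'a multiplier" where
  "scaleR r m = mk_multiplier (\<lambda>b. scaleR r (lmult m b)) (\<lambda>a. scaleR r (rmult m a))"

definition one_multiplier :: "'a multiplier" where
  "1 = mk_multiplier (\<lambda>b. b) (\<lambda>a. a)"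

definition times_multiplier :: "'a multiplier \<Rightarrow> 'a multiplier \<Rightarrow> 'a multiplier" where
  "m * n = mk_multiplier (\<lambda>b. lmult m (lmult n b)) (\<lambda>a. rmult n (rmult m a))"

definition star_multiplier :: "'a multiplier \<Rightarrow> 'a multiplier" where
  "star m = mk_multiplier (\<lambda>b. star (rmult m (star b))) (\<lambda>a. star (lmult m (star a)))"

lemma lmult_simps:
  "lmult (0::'a multiplier) b = 0"
  "lmult (m + n :: 'a multiplier) b = lmult m b + lmult n b"
  "lmult (- m :: 'a multiplier) b = - lmult m b"
  "lmult (m - n :: 'a multiplier) b = lmult m b - lmult n b"
  "lmult (scaleC c m :: 'a multiplier) b = scaleC c (lmult m b)"
  "lmult (scaleR r m :: 'a multiplier) b = scaleR r (lmult m b)"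
  "lmult (1::'a multiplier) b = b"
  "lmult (m * n :: 'a multiplier) b = lmult m (lmult n b)"
  "lmult (star m :: 'a multiplier) b = star (rmult m (star b))"
  "rmult (star m :: 'a multiplier) b = star (lmult m (star b))"
proof -
  have *: "a * star (rmult m (star b)) = star (lmult m (star a)) * b" for a b :: 'a
    by (metis multiplier_centralizer star_mult star_star)
  show "lmult (star m) b = star (rmult m (star b))" "rmult (star m) b = star (lmult m (star b))"
    using * by (simp_all add: star_multiplier_def lmult_mk rmult_mk)
qed (simp_all add: zero_multiplier_def plus_multiplier_def uminus_multiplier_def
      minus_multiplier_def scaleC_multiplier_def scaleR_multiplier_def one_multiplier_def
      times_multiplier_def lmult_mk multiplier_centralizer algebra_simps mult_scaleC_left
      mult_scaleC_right scaleR_scaleC)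

instance
proof
  fix m n k :: "'a multiplier" and c d :: complex and r s :: real
  show "m + n + k = m + (n + k)" "m + n = n + m" "0 + m = m" "- m + m = 0" "m - n = m + - n"
    "scaleR r (m + n) = scaleR r m + scaleR r n" "scaleR (r + s) m = scaleR r m + scaleR s m"
    "scaleR r (scaleR s m) = scaleR (r * s) m" "scaleR 1 m = m"
    "scaleC c (m + n) = scaleC c m + scaleC c n" "scaleC (c + d) m = scaleC c m + scaleC d m"
    "scaleC c (scaleC d m) = scaleC (c * d) m" "scaleC 1 m = m"
    "scaleR r m = scaleC (complex_of_real r) m"
    "m * n * k = m * (n * k)" "(m + n) * k = m * k + n * k" "m * (n + k) = m * n + m * k"
    "scaleC c m * n = scaleC c (m * n)" "m * scaleC c n = scaleC c (m * n)"
    "star (star m) = m" "1 * m = m" "m * 1 = m"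
    by (rule multiplier_eqI; simp add: lmult_simps lmult_add lmult_scaleC algebra_simps
          scaleC_add_right scaleC_add_left scaleC_scaleC scaleC_one scaleR_scaleC star_star)+
  have rm: "rmult (m + n) b = rmult m b + rmult n b"
    "rmult (scaleC c m) b = scaleC c (rmult m b)"
    "rmult (m * n) b = rmult n (rmult m b)" for b
    by (rule cstar_faithful_right;
        simp add: lmult_simps distrib_left distrib_right mult_scaleC_left mult_scaleC_right
          flip: multiplier_centralizer)+
  show "star (m + n) = star m + star n" "star (scaleC c m) = scaleC (cnj c) (star m)"
    "star (m * n) = star n * star m"
    by (rule multiplier_eqI; simp add: lmult_simps rm star_add star_scaleC star_star)+
qed

end

text \<open>The canonical embedding of \<open>B\<close> into \<open>M(B)\<close>.\<close>

definition multiplier_of :: "'a::cstar_algebra \<Rightarrow> 'a multiplier" where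
  "multiplier_of a = mk_multiplier (\<lambda>b. a * b) (\<lambda>b. b * a)"


section \<open>Operators on a Hilbert space\<close>

text \<open>
  Hilbert spaces are the closed subspaces \<open>K\<close> of a type \<open>'h\<close> of class
  \<^class>\<open>complex_hilbert_space\<close> (the whole type being \<open>K = UNIV\<close>).  Thus one can quantify over
  Hilbert spaces inside a formula, with \<open>'h\<close> in the role of a universe; every Hilbert space is
  isomorphic to a closed subspace of some \<open>'h\<close>.  An operator on \<open>K\<close> is a function that is
  \<^const>\<open>undefined\<close> outside \<open>K\<close>, so that equality of operators is equality on \<open>K\<close>; the product of
  operators is \<^term>\<open>compose K\<close> and the identity is \<^term>\<open>restrict (\<lambda>x. x) K\<close>.
\<close>

definition hilbert_space :: "'h::complex_hilbert_space set \<Rightarrow> bool" where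
  "hilbert_space K \<longleftrightarrow> complex_vector.subspace K \<and> closed K"

definition bounded_ops :: "'h::complex_hilbert_space set \<Rightarrow> ('h \<Rightarrow> 'h) set" where
  "bounded_ops K = {T \<in> extensional K.
     (\<forall>x\<in>K. T x \<in> K) \<and>
     (\<forall>x\<in>K. \<forall>y\<in>K. T (x + y) = T x + T y) \<and>
     (\<forall>c. \<forall>x\<in>K. T (scaleC c x) = scaleC c (T x)) \<and>
     (\<exists>C. \<forall>x\<in>K. norm (T x) \<le> C * norm x)}"

definition compact_ops :: "'h::complex_hilbert_space set \<Rightarrow> ('h \<Rightarrow> 'h) set" where
  "compact_ops K = {T \<in> bounded_ops K. compact (closure (T ` (K \<inter> cball 0 1)))}"

definition op_set_prod :: "'h set \<Rightarrow> ('h \<Rightarrow> 'h) set \<Rightarrow> ('h \<Rightarrow> 'h) set \<Rightarrow> ('h \<Rightarrow> 'h) set" where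
  "op_set_prod K X Y = {compose K S T | S T. S \<in> X \<and> T \<in> Y}"

definition is_adjoint :: "'h::complex_hilbert_space set \<Rightarrow> ('h \<Rightarrow> 'h) \<Rightarrow> ('h \<Rightarrow> 'h) \<Rightarrow> bool" where
  "is_adjoint K T S \<longleftrightarrow> S \<in> bounded_ops K \<and> (\<forall>x\<in>K. \<forall>y\<in>K. cinner (T x) y = cinner x (S y))"

definition adjoint_op :: "'h::complex_hilbert_space set \<Rightarrow> ('h \<Rightarrow> 'h) \<Rightarrow> ('h \<Rightarrow> 'h)" where
  "adjoint_op K T = (THE S. is_adjoint K T S)"

definition unitary_ops :: "'h::complex_hilbert_space set \<Rightarrow> ('h \<Rightarrow> 'h) set" where
  "unitary_ops K = {T \<in> bounded_ops K.
     compose K (adjoint_op K T) T = restrict (\<lambda>x. x) K \<and>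
     compose K T (adjoint_op K T) = restrict (\<lambda>x. x) K}"


section \<open>Representations\<close>

definition is_representation ::
    "'h::complex_hilbert_space set \<Rightarrow> ('a::star_algebra \<Rightarrow> 'h \<Rightarrow> 'h) \<Rightarrow> bool" where
  "is_representation K \<pi> \<longleftrightarrow>
     (\<forall>a. \<pi> a \<in> bounded_ops K) \<and>
     (\<forall>a b. \<forall>x\<in>K. \<pi> (a + b) x = \<pi> a x + \<pi> b x) \<and>
     (\<forall>c a. \<forall>x\<in>K. \<pi> (scaleC c a) x = scaleC c (\<pi> a x)) \<and>
     (\<forall>a b. \<pi> (a * b) = compose K (\<pi> a) (\<pi> b)) \<and>
     (\<forall>a. is_adjoint K (\<pi> a) (\<pi> (star a)))"

definition nondegenerate ::
    "'h::complex_hilbert_space set \<Rightarrow> ('a::star_algebra \<Rightarrow> 'h \<Rightarrow> 'h) \<Rightarrow> bool" where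
  "nondegenerate K \<pi> \<longleftrightarrow> closure (complex_vector.span {\<pi> a x | a x. x \<in> K}) = K"

definition Reps ::
    "'h::complex_hilbert_space set \<Rightarrow> ('a::cstar_algebra \<Rightarrow> 'h \<Rightarrow> 'h) set" where
  "Reps K = {\<pi>. is_representation K \<pi> \<and> nondegenerate K \<pi>}"

text \<open>The unique extension of a non-degenerate representation to the multiplier algebra.\<close>

definition multiplier_extension ::
    "'h::complex_hilbert_space set \<Rightarrow> ('a::cstar_algebra \<Rightarrow> 'h \<Rightarrow> 'h) \<Rightarrow> ('a multiplier \<Rightarrow> 'h \<Rightarrow> 'h)"
  where "multiplier_extension K \<pi> =
    (THE \<rho>. is_representation K \<rho> \<and> (\<forall>a. \<rho> (multiplier_of a) = \<pi> a))"

text \<open>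
  Groups are written additively, as in the class \<^class>\<open>topological_group_add\<close>, which assumes
  neither commutativity nor the Hausdorff property.
\<close>

definition group_Reps ::
    "'h::complex_hilbert_space set \<Rightarrow> ('g::topological_group_add \<Rightarrow> 'h \<Rightarrow> 'h) set" where
  "group_Reps K = {U.
     (\<forall>g. U g \<in> unitary_ops K) \<and>
     (\<forall>g h. U (g + h) = compose K (U g) (U h)) \<and>
     (\<forall>x\<in>K. continuous_on UNIV (\<lambda>g. U g x))}"


section \<open>Host algebras, C*-actions and cross representations\<close>

definition host_pullback ::
    "'h::complex_hilbert_space set \<Rightarrow> ('g \<Rightarrow> 'l::cstar_algebra multiplier) \<Rightarrow>
     ('l \<Rightarrow> 'h \<Rightarrow> 'h) \<Rightarrow> 'g \<Rightarrow> 'h \<Rightarrow> 'h" where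
  "host_pullback K \<eta> \<pi> = (\<lambda>g. multiplier_extension K \<pi> (\<eta> g))"

text \<open>
  The type argument is the universe from which the Hilbert spaces in the two conditions are taken.
\<close>

definition host_algebra ::
    "'h::complex_hilbert_space itself \<Rightarrow>
     ('g::topological_group_add \<Rightarrow> 'l::cstar_algebra multiplier) \<Rightarrow> bool" where
  "host_algebra (_ :: 'h itself) \<eta> \<longleftrightarrow>
     (\<forall>g. unitary_element (\<eta> g)) \<and>
     (\<forall>g h. \<eta> (g + h) = \<eta> g * \<eta> h) \<and>
     (\<forall>K :: 'h set. hilbert_space K \<longrightarrow>
        (\<forall>\<pi>\<in>Reps K. host_pullback K \<eta> \<pi> \<in> group_Reps K) \<and>
        inj_on (host_pullback K \<eta>) (Reps K))"

definition L_representations ::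
    "'h::complex_hilbert_space set \<Rightarrow> ('g \<Rightarrow> 'l::cstar_algebra multiplier) \<Rightarrow>
     ('g \<Rightarrow> 'h \<Rightarrow> 'h) set" where
  "L_representations K \<eta> = host_pullback K \<eta> ` Reps K"

definition host_rep ::
    "'h::complex_hilbert_space set \<Rightarrow> ('g \<Rightarrow> 'l::cstar_algebra multiplier) \<Rightarrow>
     ('g \<Rightarrow> 'h \<Rightarrow> 'h) \<Rightarrow> 'l \<Rightarrow> 'h \<Rightarrow> 'h" where
  "host_rep K \<eta> U = inv_into (Reps K) (host_pullback K \<eta>) U"

definition star_automorphism :: "('a::star_algebra \<Rightarrow> 'a) \<Rightarrow> bool" where
  "star_automorphism \<phi> \<longleftrightarrow> bij \<phi> \<and>
     (\<forall>a b. \<phi> (a + b) = \<phi> a + \<phi> b) \<and>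
     (\<forall>c a. \<phi> (scaleC c a) = scaleC c (\<phi> a)) \<and>
     (\<forall>a b. \<phi> (a * b) = \<phi> a * \<phi> b) \<and>
     (\<forall>a. \<phi> (star a) = star (\<phi> a))"

definition cstar_action ::
    "('g::topological_group_add \<Rightarrow> 'a::cstar_algebra \<Rightarrow> 'a) \<Rightarrow> bool" where
  "cstar_action \<alpha> \<longleftrightarrow> (\<forall>g. star_automorphism (\<alpha> g)) \<and> (\<forall>g h. \<alpha> (g + h) = \<alpha> g \<circ> \<alpha> h)"

definition covariant_L_Reps ::
    "'h::complex_hilbert_space set \<Rightarrow> ('g::topological_group_add \<Rightarrow> 'a::cstar_algebra \<Rightarrow> 'a) \<Rightarrow>
     ('g \<Rightarrow> 'l::cstar_algebra multiplier) \<Rightarrow> (('a \<Rightarrow> 'h \<Rightarrow> 'h) \<times> ('g \<Rightarrow> 'h \<Rightarrow> 'h)) set" where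
  "covariant_L_Reps K \<alpha> \<eta> = {(\<pi>, U).
     \<pi> \<in> Reps K \<and> U \<in> L_representations K \<eta> \<and>
     (\<forall>g a. compose K (U g) (compose K (\<pi> a) (adjoint_op K (U g))) = \<pi> (\<alpha> g a))}"

definition cross_representation ::
    "'h::complex_hilbert_space set \<Rightarrow> ('g::topological_group_add \<Rightarrow> 'a::cstar_algebra \<Rightarrow> 'a) \<Rightarrow>
     ('g \<Rightarrow> 'l::cstar_algebra multiplier) \<Rightarrow> ('a \<Rightarrow> 'h \<Rightarrow> 'h) \<Rightarrow> ('g \<Rightarrow> 'h \<Rightarrow> 'h) \<Rightarrow> bool" where
  "cross_representation K \<alpha> \<eta> \<pi> U \<longleftrightarrow>
     (\<pi>, U) \<in> covariant_L_Reps K \<alpha> \<eta> \<and>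
     op_set_prod K (range \<pi>) (range (host_rep K \<eta> U))
       \<subseteq> op_set_prod K (range (host_rep K \<eta> U)) (bounded_ops K)"

end

theory Submission
  imports Defs
begin

text \<open>
  Write \<open>\<rho>\<close> for the non-degenerate representation \<open>U\<^sub>L\<close> of the C*-algebra \<open>L\<close>.  The claim is that
  each compact operator \<open>T = \<pi>(A) \<rho>(L)\<close> has the form \<open>\<rho>(p) S\<close> with \<open>p\<close> in the algebra and \<open>S\<close>
  bounded.  Along an approximate identity, \<open>\<rho>(e)\<close> converges to the identity strongly, hence uniformly
  on the relatively compact image under \<open>T\<close> of the unit ball; so \<open>\<rho>(e) T\<close> converges to \<open>T\<close> in norm
  (\<open>approx_unit_fixes_compact\<close>).  Cohen's factorization method then applies (\<open>cohen_factorization\<close>).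
  If \<open>\<rho>\<close> itself takes compact values, so does \<open>\<pi>(A) \<rho>(L)\<close>, because the compact operators form an
  ideal.

  Two facts of C*-theory are needed: a bounded approximate identity exists, and representations are
  contractive.  Contractivity follows from a square
  root of \<open>1 - a\<^sup>* a\<close>, found as a fixed point (\<open>ex_sqrt_one_minus\<close>).  For approximate units, a
  small selfadjoint \<open>h\<close> has a Cayley transform \<open>w\<close>, a unitary of the unitization with \<open>h\<close> in the
  ideal generated by \<open>1 - w\<close>; the averages of the powers of \<open>w\<close> have norm at most one, differ from
  \<open>1\<close> by an element of the algebra, and nearly annihilate \<open>1 - w\<close>, hence \<open>h\<close>
  (\<open>ex_mean_of_isometry\<close>, \<open>ex_nonexpansive_approx_unit\<close>).

  In the formal text, an element \<open>1 - e\<close> of the unitization is represented by the operator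
  \<open>x \<mapsto> x - e x\<close> on the algebra.
\<close>

section \<open>Elementary C*-algebra\<close>

lemma star_minus: "star (x - y) = star x - star y" for x y :: "'a::star_algebra"
  by (metis star_add diff_add_cancel add_diff_cancel_right')

lemma star_zero: "star 0 = (0::'a::star_algebra)"
  using star_minus[of 0 "0::'a"] by simp

lemma star_scaleR: "star (r *\<^sub>R x) = r *\<^sub>R star x" for x :: "'a::star_algebra"
  by (simp add: scaleR_scaleC star_scaleC)

lemma norm_star: "norm (star x) = norm x" for x :: "'a::cstar_algebra"
proof -
  have *: "norm y \<le> norm (star y)" for y :: 'a
  proof (cases "y = 0")
    case False
    have "norm y * norm y \<le> norm (star y) * norm y"
      using cstar_identity[of y] norm_mult_ineq[of "star y" y] by (simp add: power2_eq_square)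
    then show ?thesis using False by simp
  qed simp
  show ?thesis using *[of x] *[of "star x"] by (simp add: star_star)
qed

lemma cstar_identity': "norm (x * star x) = (norm x)\<^sup>2" for x :: "'a::cstar_algebra"
  using cstar_identity[of "star x"] by (simp add: star_star norm_star)

text \<open>
  Left multiplication on a C*-algebra is isometric: testing \<open>c\<close> on \<open>c\<^sup>*\<close> recovers \<open>\<parallel>c\<parallel>\<close>.  So an
  estimate for a left multiplication operator gives a norm estimate.
\<close>

lemma norm_le_if_left_mult_le:
  fixes c :: "'a::cstar_algebra"
  assumes "\<And>x. norm (c * x) \<le> M * norm x" "0 \<le> M"
  shows "norm c \<le> M"
proof (cases "c = 0")
  case False
  have "norm c * norm c \<le> M * norm c"
    using assms(1)[of "star c"] by (simp add: cstar_identity' norm_star power2_eq_square)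
  then show ?thesis using False by simp
qed (use assms in simp)

lemma continuous_on_star: "continuous_on A (star :: 'a::cstar_algebra \<Rightarrow> 'a)"
  unfolding continuous_on_iff by (metis dist_norm norm_star star_minus)

text \<open>
  In the unitization, \<open>1 + y\<close> is the inverse of \<open>1 - a\<close> and \<open>y\<close> is the sum of the Neumann series
  \<open>a + a\<^sup>2 + \<dots>\<close>, obtained as the fixed point of \<open>y \<mapsto> a + a y\<close>; it is also that of
  \<open>y \<mapsto> a + y a\<close>, as left and right inverses agree.
\<close>

lemma ex_quasi_inverse:
  fixes a :: "'a::cstar_algebra"
  assumes a: "norm a < 1"
  obtains y where "y = a + a * y" "y = a + y * a" "(1 - norm a) * norm y \<le> norm a"
proof -
  have c: "complete (UNIV :: 'a set)" by (rule complete_UNIV)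
  have "\<exists>!y\<in>UNIV. a + a * y = y"
  proof (rule Banach_fix[OF c, of "norm a"])
    show "dist (a + a * x) (a + a * y) \<le> norm a * dist x y" for x y
      by (simp add: dist_norm norm_mult_ineq flip: right_diff_distrib)
  qed (use a in auto)
  then obtain y where y: "a + a * y = y" by auto
  have "\<exists>!y\<in>UNIV. a + y * a = y"
  proof (rule Banach_fix[OF c, of "norm a"])
    show "dist (a + x * a) (a + y * a) \<le> norm a * dist x y" for x y
      by (simp add: dist_norm norm_mult_ineq mult.commute[of "norm a"] flip: left_diff_distrib)
  qed (use a in auto)
  then obtain z where z: "a + z * a = z" by auto
  have "z * (a + a * y) = (a + z * a) * y" by (simp only: y z)
  then have "z * a = a * y" by (simp add: algebra_simps)
  then have "z = y" using y z by simp
  moreover have "norm y \<le> norm a + norm a * norm y"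
    using norm_triangle_ineq[of a "a * y"] norm_mult_ineq[of a y] y by simp
  then have "(1 - norm a) * norm y \<le> norm a" by (simp add: algebra_simps)
  ultimately show ?thesis using that[of y] y z by simp
qed

text \<open>
  Here \<open>1 - y\<close> is a square root of \<open>1 - h\<close>.  The map \<open>y \<mapsto> (h + y\<^sup>2) / 2\<close> has Lipschitz constant \<open>r\<close> on the
  ball of radius \<open>r = 1 - sqrt (1 - \<parallel>h\<parallel>) < 1\<close>, which it maps into itself because
  \<open>(\<parallel>h\<parallel> + r\<^sup>2) / 2 = r\<close>, and it preserves selfadjointness.
\<close>

lemma ex_sqrt_one_minus:
  fixes h :: "'a::cstar_algebra"
  assumes "star h = h" "norm h < 1"
  obtains y where "star y = y" "h = 2 *\<^sub>R y - y * y"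
proof -
  define r where "r = 1 - sqrt (1 - norm h)"
  have s: "0 < sqrt (1 - norm h)" "sqrt (1 - norm h) \<le> 1" "(sqrt (1 - norm h))\<^sup>2 = 1 - norm h"
    using assms by auto
  have r: "0 \<le> r" "r < 1" "norm h + r\<^sup>2 = 2 * r"
    using s by (simp_all add: r_def power2_diff)
  define B where "B = {y::'a. norm y \<le> r \<and> star y = y}"
  have "closed {y::'a. norm y \<le> r \<and> star y = y}"
    by (intro closed_Collect_conj closed_Collect_le closed_Collect_eq continuous_intros continuous_on_star)
  then have B: "complete B" by (simp add: B_def complete_eq_closed)
  have "\<exists>!y\<in>B. (1/2) *\<^sub>R (h + y * y) = y"
  proof (rule Banach_fix[OF B, of r])
    show "B \<noteq> {}" using r by (auto simp: B_def star_zero intro!: exI[of _ 0])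
    have "norm ((1/2) *\<^sub>R (h + y * y)) \<le> r" if "norm y \<le> r" for y
    proof -
      have "norm (y * y) \<le> r\<^sup>2"
        by (metis that norm_ge_zero norm_mult_ineq order_trans power2_eq_square mult_mono' )
      then show ?thesis using r norm_triangle_ineq[of h "y * y"] by simp
    qed
    then show "(\<lambda>y. (1/2) *\<^sub>R (h + y * y)) ` B \<subseteq> B"
      using assms(1) by (auto simp: B_def star_scaleR star_add star_mult)
    fix x y assume xy: "x \<in> B" "y \<in> B"
    show "dist ((1/2) *\<^sub>R (h + x * x)) ((1/2) *\<^sub>R (h + y * y)) \<le> r * dist x y"
    proof -
      have "x * x - y * y = x * (x - y) + (x - y) * y" by (simp add: algebra_simps)
      then have "norm (x * x - y * y) \<le> norm x * norm (x - y) + norm (x - y) * norm y"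
        by (metis norm_triangle_le add_mono norm_mult_ineq)
      also have "\<dots> \<le> r * norm (x - y) + norm (x - y) * r"
        using xy r by (intro add_mono mult_mono) (auto simp: B_def)
      finally show "dist ((1/2) *\<^sub>R (h + x * x)) ((1/2) *\<^sub>R (h + y * y)) \<le> r * dist x y"
        by (simp add: dist_norm flip: scaleR_diff_right)
    qed
  qed (use r in auto)
  then obtain y where y: "y \<in> B" "(1/2) *\<^sub>R (h + y * y) = y" by auto
  from y(2) have "2 *\<^sub>R y = h + y * y" by (metis scaleR_half_double scaleR_2 scaleR_right_distrib)
  with y(1) show ?thesis using that[of y] by (simp add: B_def algebra_simps)
qed

section \<open>Approximate units\<close>

text \<open>
  The condition says that \<open>1 - e\<close>, as a multiplier of the algebra, has norm at most one.
\<close>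

definition nonexpansive_complement :: "'a::cstar_algebra \<Rightarrow> bool" where
  "nonexpansive_complement e \<longleftrightarrow> (\<forall>x. norm (x - e * x) \<le> norm x)"

lemma nonexpansive_complementD: "nonexpansive_complement e \<Longrightarrow> norm (x - e * x) \<le> norm x"
  by (simp add: nonexpansive_complement_def)

lemma norm_le_2_if_nonexpansive_complement:
  assumes "nonexpansive_complement e"
  shows "norm e \<le> 2"
proof (rule norm_le_if_left_mult_le)
  show "norm (e * x) \<le> 2 * norm x" for x
    using norm_triangle_ineq4[of x "x - e * x"] nonexpansive_complementD[OF assms, of x] by simp
qed simp

lemma nonexpansive_complement_star:
  fixes e :: "'a::cstar_algebra"
  assumes "nonexpansive_complement e"
  shows "nonexpansive_complement (star e)"
  unfolding nonexpansive_complement_def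
proof
  fix x
  let ?y = "x - star e * x"
  have "(norm ?y)\<^sup>2 = norm (star ?y * ?y)" by (simp add: cstar_identity)
  also have "star ?y * ?y = star x * (?y - e * ?y)"
    by (simp add: star_minus star_mult star_star algebra_simps)
  also have "norm \<dots> \<le> norm x * norm ?y"
    using norm_mult_ineq[of "star x" "?y - e * ?y"]
      mult_left_mono[OF nonexpansive_complementD[OF assms, of ?y] norm_ge_zero[of x]]
    by (simp add: norm_star)
  finally show "norm ?y \<le> norm x"
    by (cases "?y = 0") (simp_all add: power2_eq_square)
qed

text \<open>
  The circle product of ring theory: \<open>1 - quasi_mult a b = (1 - a) (1 - b)\<close> in the unitization.
\<close>

definition quasi_mult :: "'a::ring \<Rightarrow> 'a \<Rightarrow> 'a" where
  "quasi_mult a b = a + b - a * b"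

lemma complement_quasi_mult:
  "x - quasi_mult a b * x = (x - b * x) - a * (x - b * x)"
  by (simp add: quasi_mult_def algebra_simps)

lemma star_quasi_mult: "star (quasi_mult a b) = quasi_mult (star b) (star a)"
  for a b :: "'a::star_algebra"
  by (simp add: quasi_mult_def star_minus star_add star_mult add.commute)

lemma nonexpansive_complement_quasi_mult:
  "nonexpansive_complement a \<Longrightarrow> nonexpansive_complement b \<Longrightarrow> nonexpansive_complement (quasi_mult a b)"
  unfolding nonexpansive_complement_def complement_quasi_mult by (meson order_trans)

text \<open>
  With \<open>b = \<i> h\<close>, the element \<open>1 + 2 y = (1 + b) (1 - b)\<^sup>-\<^sup>1\<close> is the Cayley transform of \<open>h\<close>, a
  unitary of the unitization.  Unitarity amounts to \<open>2 y\<^sup>* y + y\<^sup>* + y = 0\<close>, and the C*-identity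
  turns it into isometry.
\<close>

lemma isometry_of_cayley:
  fixes h :: "'a::cstar_algebra"
  assumes h: "star h = h" and y: "y = scaleC \<i> h + scaleC \<i> h * y"
  shows "norm (x + 2 *\<^sub>R (y * x)) = norm x"
proof -
  define b where "b = scaleC \<i> h"
  have b: "star b = - b"
    by (simp add: b_def star_scaleC h complex_vector.scale_minus_left)
  have y1: "b * y = y - b" using y by (simp add: b_def algebra_simps)
  have "star y * star b = star y - star b"
    using arg_cong[OF y1, of star] by (simp add: star_mult star_minus)
  then have y2: "star y * b = - b - star y"
    by (simp add: b minus_equation_iff[of "star y * b"]) (metis add.commute diff_conv_add_uminus)
  have "star y * (b * y) = star y * y - star y * b" by (simp add: y1 algebra_simps)
  moreover have "star y * (b * y) = - b * y - star y * y"
    by (metis y2 mult.assoc left_diff_distrib)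
  ultimately have "star y * y - (- b - star y) = - (y - b) - star y * y"
    by (simp add: y1 y2)
  then have *: "2 *\<^sub>R (star y * y) + star y + y = 0"
    by (simp add: scaleR_2 algebra_simps)
  let ?z = "x + 2 *\<^sub>R (y * x)"
  have "star ?z * ?z = star x * x + 2 *\<^sub>R (star x * (2 *\<^sub>R (star y * y) + star y + y) * x)"
    by (simp add: star_add star_scaleR star_mult algebra_simps)
  then have "star ?z * ?z = star x * x" by (simp add: *)
  then have "(norm ?z)\<^sup>2 = (norm x)\<^sup>2" by (metis cstar_identity)
  then show ?thesis by simp
qed


text \<open>
  The mean ergodic trick.  Let \<open>W = 1 + 2 y\<close> and let \<open>1 - e\<close> be the average of \<open>1, W, \<dots>, W\<^sup>n\<^sup>-\<^sup>1\<close>.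
  An average of isometries is nonexpansive, and \<open>(1 - e) (W - 1) = (W\<^sup>n - 1) / n\<close> telescopes, so
  that \<open>1 - e\<close> almost annihilates the range of \<open>y = (W - 1) / 2\<close>.
\<close>

lemma ex_mean_of_isometry:
  fixes y :: "'a::cstar_algebra"
  assumes iso: "\<And>x. norm (x + 2 *\<^sub>R (y * x)) = norm x" and n: "0 < n"
  obtains e where "nonexpansive_complement e"
    "\<And>x. norm (y * x - e * (y * x)) \<le> norm x / real n"
proof -
  define W where "W x = x + 2 *\<^sub>R (y * x)" for x
  have "\<exists>v. \<forall>x. (W ^^ k) x = x - v * x" for k
  proof (induction k)
    case 0
    show ?case by (auto intro: exI[of _ 0])
  next
    case (Suc k)
    then obtain v where v: "\<And>x. (W ^^ k) x = x - v * x" by blast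
    have "(W ^^ Suc k) x = W (x - v * x)" for x by (simp add: v)
    moreover have "W (x - v * x) = x - (v - 2 *\<^sub>R y + 2 *\<^sub>R (y * v)) * x" for x
      by (simp add: W_def algebra_simps)
    ultimately have "(W ^^ Suc k) x = x - (v - 2 *\<^sub>R y + 2 *\<^sub>R (y * v)) * x" for x
      by (rule trans)
    then show ?case by blast
  qed
  then obtain v where v: "\<And>k x. (W ^^ k) x = x - v k * x" by metis
  have iso_k: "norm ((W ^^ k) x) = norm x" for k x
    by (induction k) (simp_all add: W_def iso)
  define e where "e = (1 / real n) *\<^sub>R (\<Sum>k<n. v k)"
  have mean: "x - e * x = (1 / real n) *\<^sub>R (\<Sum>k<n. (W ^^ k) x)" for x
  proof -
    have "e * x = (1 / real n) *\<^sub>R (\<Sum>k<n. v k * x)"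
      by (simp add: e_def sum_distrib_right)
    moreover have "(\<Sum>k<n. (W ^^ k) x) = real n *\<^sub>R x - (\<Sum>k<n. v k * x)"
      unfolding v by (simp add: sum_subtractf scaleR_conv_of_real sum_constant_scaleR)
    ultimately show ?thesis using n by (simp add: scaleR_diff_right)
  qed
  have "nonexpansive_complement e"
    unfolding nonexpansive_complement_def
  proof
    fix x
    have "norm (\<Sum>k<n. (W ^^ k) x) \<le> real n * norm x"
      by (rule order_trans[OF norm_sum]) (simp add: iso_k)
    then show "norm (x - e * x) \<le> norm x"
      using n by (simp add: mean divide_simps mult.commute)
  qed
  moreover have "norm (y * x - e * (y * x)) \<le> norm x / real n" for x
  proof -
    have "2 *\<^sub>R (y * x - e * (y * x)) = (W x - e * W x) - (x - e * x)"
      by (simp add: W_def algebra_simps)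
    also have "\<dots> = (1 / real n) *\<^sub>R (\<Sum>k<n. (W ^^ Suc k) x - (W ^^ k) x)"
      unfolding mean by (simp add: funpow_swap1 sum_subtractf scaleR_diff_right)
    also have "\<dots> = (1 / real n) *\<^sub>R ((W ^^ n) x - x)"
      using sum_lessThan_telescope[of "\<lambda>k. (W ^^ k) x" n] by simp
    finally have "2 * norm (y * x - e * (y * x)) = norm ((1 / real n) *\<^sub>R ((W ^^ n) x - x))"
      by (metis norm_scaleR abs_numeral)
    also have "\<dots> \<le> (norm x + norm x) / real n"
      using norm_triangle_ineq4[of "(W ^^ n) x" x] n by (simp add: iso_k divide_simps)
    finally show ?thesis by simp
  qed
  ultimately show ?thesis using that by blast
qed

text \<open>
  After rescaling to \<open>\<parallel>a\<parallel> < 1\<close>, put \<open>h = a a\<^sup>*\<close> and \<open>b = \<i> h\<close>.  Since \<open>b = y (1 - b)\<close> for the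
  quasi-inverse \<open>y\<close> of \<open>b\<close>, the means of the Cayley transform make \<open>(1 - e) h\<close> small, and
  \<open>\<parallel>(1 - e) a\<parallel>\<^sup>2 = \<parallel>(1 - e) h (1 - e)\<^sup>*\<parallel>\<close>.
\<close>

lemma ex_nonexpansive_approx_unit:
  fixes a :: "'a::cstar_algebra"
  assumes \<epsilon>: "0 < \<epsilon>"
  obtains e where "nonexpansive_complement e" "norm (a - e * a) < \<epsilon>"
proof -
  have small: "\<exists>e. nonexpansive_complement e \<and> norm (c - e * c) < \<delta>"
    if c: "norm c < 1" and \<delta>: "0 < \<delta>" for c :: 'a and \<delta> :: real
  proof -
    define h where "h = c * star c"
    define b where "b = scaleC \<i> h"
    have h: "star h = h" "norm h < 1"
      using c by (simp_all add: h_def star_mult star_star cstar_identity' abs_square_less_1)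
    have nb: "norm b < 1" using h by (simp add: b_def norm_scaleC)
    obtain y where y: "y = b + b * y" "y = b + y * b"
      using ex_quasi_inverse[OF nb] by blast
    have iso: "norm (x + 2 *\<^sub>R (y * x)) = norm x" for x
      using isometry_of_cayley[OF h(1)] y(1) by (simp add: b_def)
    \<comment> \<open>The final estimate is \<open>\<parallel>(1 - e) c\<parallel>\<^sup>2 \<le> 2/n + (2/n) \<cdot> 2\<close>, since \<open>\<parallel>(1 - e) h\<parallel> \<le> 2/n\<close> and \<open>\<parallel>e\<parallel> \<le> 2\<close>.\<close>
    obtain n :: nat where n: "6 / \<delta>\<^sup>2 < real n" using reals_Archimedean2 by blast
    then have n0: "0 < n" using \<delta> by (metis divide_pos_pos of_nat_0_less_iff order_less_trans zero_less_numeral zero_less_power)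
    obtain e where e: "nonexpansive_complement e"
        "\<And>x. norm (y * x - e * (y * x)) \<le> norm x / real n"
      using ex_mean_of_isometry[OF iso n0] by blast
    have "norm ((b - e * b) * x) \<le> (2 / real n) * norm x" for x
    proof -
      have "y * x = b * x + y * b * x" using y(2) by (metis distrib_right)
      then have bx: "b * x = y * (x - b * x)" by (simp add: algebra_simps)
      have "(b - e * b) * x = b * x - e * (b * x)" by (simp add: algebra_simps)
      also have "norm \<dots> \<le> norm (x - b * x) / real n"
        using e(2)[of "x - b * x"] by (simp flip: bx)
      also have "norm (x - b * x) \<le> norm x + norm b * norm x"
        using norm_triangle_ineq4[of x "b * x"] norm_mult_ineq[of b x] by linarith
      also have "\<dots> \<le> 2 * norm x" using nb mult_right_mono[of "norm b" 1 "norm x"] by simp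
      finally show ?thesis using n0 by (simp add: divide_right_mono)
    qed
    then have "norm (b - e * b) \<le> 2 / real n"
      by (rule norm_le_if_left_mult_le) simp
    moreover have "b - e * b = scaleC \<i> (h - e * h)"
      by (simp add: b_def mult_scaleC_right complex_vector.scale_right_diff_distrib)
    ultimately have h_e: "norm (h - e * h) \<le> 2 / real n" by (simp add: norm_scaleC)
    have "(norm (c - e * c))\<^sup>2 = norm ((h - e * h) - (h - e * h) * star e)"
      unfolding cstar_identity'[symmetric]
      by (simp add: h_def star_minus star_mult algebra_simps)
    also have "\<dots> \<le> norm (h - e * h) + norm (h - e * h) * norm (star e)"
      by (meson norm_triangle_ineq4 norm_mult_ineq add_left_mono order_trans)
    also have "\<dots> \<le> 2 / real n + 2 / real n * 2"
      using h_e norm_le_2_if_nonexpansive_complement[OF e(1)]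
      by (intro add_mono mult_mono) (auto simp: norm_star)
    also have "\<dots> < \<delta>\<^sup>2" using n n0 \<delta> by (simp add: field_simps)
    finally show ?thesis using e(1) \<delta> by (meson power2_less_imp_less less_imp_le)
  qed
  define r where "r = norm a + 1"
  have r: "0 < r" "norm a < r" by (simp_all add: r_def add_nonneg_pos)
  obtain e where e: "nonexpansive_complement e"
      "norm ((1 / r) *\<^sub>R a - e * ((1 / r) *\<^sub>R a)) < \<epsilon> / r"
    using small[of "(1 / r) *\<^sub>R a" "\<epsilon> / r"] r \<epsilon> by auto
  have "(1 / r) *\<^sub>R a - e * ((1 / r) *\<^sub>R a) = (1 / r) *\<^sub>R (a - e * a)"
    by (simp add: scaleR_diff_right)
  with e r show ?thesis using that[of e] by (simp add: divide_simps)
qed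

text \<open>
  Induction on \<open>F\<close>: if \<open>e\<close> serves \<open>F\<close>, choose \<open>f\<close> for the single element \<open>(1 - e) a\<close>.  Then
  \<open>(1 - f) (1 - e)\<close> is nonexpansive and almost annihilates \<open>a\<close> and all of \<open>F\<close>; multiplying it on
  the left by its adjoint makes it selfadjoint and preserves both properties.
\<close>

lemma ex_selfadjoint_approx_unit_finite:
  fixes F :: "'a::cstar_algebra set"
  assumes "finite F" and \<epsilon>: "0 < \<epsilon>"
  obtains e where "star e = e" "nonexpansive_complement e" "\<And>a. a \<in> F \<Longrightarrow> norm (a - e * a) < \<epsilon>"
proof -
  have "\<exists>e. star e = e \<and> nonexpansive_complement e \<and> (\<forall>a\<in>F. norm (a - e * a) < \<epsilon>)"
    using \<open>finite F\<close>
  proof induction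
    case empty
    have "nonexpansive_complement (0::'a)" by (simp add: nonexpansive_complement_def)
    then show ?case using star_zero by blast
  next
    case (insert a F)
    then obtain e where e: "star e = e" "nonexpansive_complement e"
        "\<And>a. a \<in> F \<Longrightarrow> norm (a - e * a) < \<epsilon>" by blast
    obtain f where f: "nonexpansive_complement f"
        "norm ((a - e * a) - f * (a - e * a)) < \<epsilon>"
      using ex_nonexpansive_approx_unit[OF \<epsilon>] by blast
    define g where "g = quasi_mult (quasi_mult (star e) (star f)) (quasi_mult f e)"
    have qe: "nonexpansive_complement (quasi_mult (star e) (star f))"
      using e(2) f(1) by (simp add: nonexpansive_complement_quasi_mult nonexpansive_complement_star)
    have g: "norm (x - g * x) \<le> norm ((x - e * x) - f * (x - e * x))" for x
      unfolding g_def complement_quasi_mult[of x _ "quasi_mult f e"] complement_quasi_mult[of x f e]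
      by (rule nonexpansive_complementD[OF qe])
    have "nonexpansive_complement g"
      unfolding g_def using qe e(2) f(1) by (simp add: nonexpansive_complement_quasi_mult)
    moreover have "star g = g" by (simp add: g_def star_quasi_mult star_star)
    moreover have "norm (x - g * x) < \<epsilon>" if "x \<in> insert a F" for x
    proof (cases "x = a")
      case True
      then show ?thesis using g[of a] f(2) by simp
    next
      case False
      then show ?thesis using that e(3)[of x] g[of x] nonexpansive_complementD[OF f(1), of "x - e * x"] by simp
    qed
    ultimately show ?case by blast
  qed
  then show ?thesis using that by blast
qed

definition approx_units :: "'a::cstar_algebra set \<Rightarrow> real \<Rightarrow> 'a set" where
  "approx_units F \<epsilon> = {e. star e = e \<and> nonexpansive_complement e \<and> (\<forall>a\<in>F. norm (a - e * a) < \<epsilon>)}"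

text \<open>
  An approximate identity of the algebra as a filter: a property holds eventually if all approximate
  units for some finite set and some tolerance have it.
\<close>

definition approx_unit_filter :: "'a::cstar_algebra filter" where
  "approx_unit_filter = (INF (F, \<epsilon>)\<in>{F. finite F} \<times> {0<..}. principal (approx_units F \<epsilon>))"

lemma eventually_approx_unit_filter:
  "eventually P approx_unit_filter \<longleftrightarrow>
    (\<exists>F \<epsilon>. finite F \<and> 0 < \<epsilon> \<and> (\<forall>e\<in>approx_units F \<epsilon>. P e))"
proof -
  have "eventually P approx_unit_filter \<longleftrightarrow>
    (\<exists>i\<in>{F. finite F} \<times> {0<..}. eventually P (case i of (F, \<epsilon>) \<Rightarrow> principal (approx_units F \<epsilon>)))"
    unfolding approx_unit_filter_def
  proof (rule eventually_INF_base)
    fix i j :: "'a set \<times> real"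
    assume ij: "i \<in> {F. finite F} \<times> {0<..}" "j \<in> {F. finite F} \<times> {0<..}"
    let ?k = "(fst i \<union> fst j, min (snd i) (snd j))"
    have "approx_units (fst ?k) (snd ?k) \<subseteq> approx_units (fst i) (snd i) \<inter> approx_units (fst j) (snd j)"
      by (auto simp: approx_units_def)
    then show "\<exists>k\<in>{F. finite F} \<times> {0<..}. (case k of (F, \<epsilon>) \<Rightarrow> principal (approx_units F \<epsilon>)) \<le>
        inf (case i of (F, \<epsilon>) \<Rightarrow> principal (approx_units F \<epsilon>)) (case j of (F, \<epsilon>) \<Rightarrow> principal (approx_units F \<epsilon>))"
      using ij by (intro bexI[of _ ?k]) (auto simp: split_beta)
  qed (auto intro!: exI[of _ "{}"] exI[of _ "1::real"])
  then show ?thesis by (auto simp: eventually_principal)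
qed

lemma approx_unit_filter_nontrivial: "approx_unit_filter \<noteq> bot"
proof -
  have "\<not> eventually (\<lambda>e :: 'a. False) approx_unit_filter"
    unfolding eventually_approx_unit_filter approx_units_def
    by (auto elim!: ex_selfadjoint_approx_unit_finite)
  then show ?thesis by (simp add: trivial_limit_def)
qed

lemma eventually_approx_unit:
  "eventually (\<lambda>e. star e = e \<and> nonexpansive_complement e) approx_unit_filter"
  unfolding eventually_approx_unit_filter
  by (intro exI[of _ "{}"] exI[of _ "1::real"]) (simp add: approx_units_def)

lemma tendsto_approx_unit_left: "((\<lambda>e. e * a) \<longlongrightarrow> a) approx_unit_filter"
  unfolding tendsto_iff eventually_approx_unit_filter
proof safe
  fix \<epsilon> :: real assume "0 < \<epsilon>"
  then show "\<exists>F \<delta>. finite F \<and> 0 < \<delta> \<and> (\<forall>e\<in>approx_units F \<delta>. dist (e * a) a < \<epsilon>)"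
    by (intro exI[of _ "{a}"] exI[of _ \<epsilon>]) (simp add: approx_units_def dist_norm norm_minus_commute)
qed

text \<open>
  Selfadjointness of the approximate units transfers convergence from the left to the right.
\<close>

lemma tendsto_approx_unit_right: "((\<lambda>e. a * e) \<longlongrightarrow> a) approx_unit_filter"
  unfolding tendsto_iff
proof safe
  fix \<epsilon> :: real assume "0 < \<epsilon>"
  with tendsto_approx_unit_left[of "star a"]
  have "eventually (\<lambda>e. dist (e * star a) (star a) < \<epsilon>) approx_unit_filter"
    by (simp add: tendsto_iff)
  with eventually_approx_unit
  show "eventually (\<lambda>e. dist (a * e) a < \<epsilon>) approx_unit_filter"
  proof eventually_elim
    case (elim e)
    then have "star (a * e - a) = e * star a - star a" by (simp add: star_minus star_mult)
    with elim show ?case by (metis dist_norm norm_star)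
  qed
qed

section \<open>Operators on a closed subspace\<close>

lemma cinner_add_left: "cinner (x + y) z = cinner x z + cinner y z"
  for x y z :: "'h::complex_hilbert_space"
  by (metis cinner_add_right cinner_commute complex_cnj_add)

lemma cinner_diff_right: "cinner x (y - z) = cinner x y - cinner x z"
  for x y z :: "'h::complex_hilbert_space"
  using cinner_add_right[of x "y - z" z] by simp

lemma cinner_diff_left: "cinner (x - y) z = cinner x z - cinner y z"
  for x y z :: "'h::complex_hilbert_space"
  using cinner_add_left[of "x - y" y z] by simp

lemma tendsto_scaleC:
  fixes f :: "'i \<Rightarrow> 'h::complex_normed_vector"
  assumes "(f \<longlongrightarrow> l) F"
  shows "((\<lambda>i. scaleC c (f i)) \<longlongrightarrow> scaleC c l) F"
proof -
  have "((\<lambda>i. cmod c * norm (f i - l)) \<longlongrightarrow> 0) F"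
    using LIM_zero[OF assms] by (intro tendsto_mult_right_zero tendsto_norm_zero)
  then have "((\<lambda>i. norm (scaleC c (f i) - scaleC c l)) \<longlongrightarrow> 0) F"
    by (simp add: norm_scaleC flip: complex_vector.scale_right_diff_distrib)
  then show ?thesis
    by (rule LIM_zero_cancel[OF tendsto_norm_zero_cancel])
qed

lemma hilbert_space_mem:
  assumes "hilbert_space K"
  shows "0 \<in> K" "x \<in> K \<Longrightarrow> y \<in> K \<Longrightarrow> x + y \<in> K" "x \<in> K \<Longrightarrow> y \<in> K \<Longrightarrow> x - y \<in> K"
    "x \<in> K \<Longrightarrow> scaleC c x \<in> K" "x \<in> K \<Longrightarrow> r *\<^sub>R x \<in> K"
  using assms complex_vector.subspace_0[of K] complex_vector.subspace_add[of K]
    complex_vector.subspace_diff[of K] complex_vector.subspace_scale[of K]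
  by (simp_all add: hilbert_space_def scaleR_scaleC)

lemma bounded_opsD:
  assumes "T \<in> bounded_ops K"
  shows "x \<in> K \<Longrightarrow> T x \<in> K" "x \<in> K \<Longrightarrow> y \<in> K \<Longrightarrow> T (x + y) = T x + T y"
    "x \<in> K \<Longrightarrow> T (scaleC c x) = scaleC c (T x)" "x \<in> K \<Longrightarrow> T (r *\<^sub>R x) = r *\<^sub>R T x"
    "T \<in> extensional K"
  using assms by (auto simp: bounded_ops_def scaleR_scaleC)

lemma bounded_ops_diff:
  assumes "T \<in> bounded_ops K" "hilbert_space K" "x \<in> K" "y \<in> K"
  shows "T (x - y) = T x - T y"
  using bounded_opsD(2)[OF assms(1), of "x - y" y] assms(2-4) by (simp add: hilbert_space_mem)

lemma bounded_ops_bound: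
  assumes "T \<in> bounded_ops K"
  obtains C where "0 \<le> C" "\<And>x. x \<in> K \<Longrightarrow> norm (T x) \<le> C * norm x"
proof -
  from assms obtain C where C: "\<And>x. x \<in> K \<Longrightarrow> norm (T x) \<le> C * norm x"
    unfolding bounded_ops_def by blast
  have "norm (T x) \<le> \<bar>C\<bar> * norm x" if "x \<in> K" for x
    using C[OF that] mult_right_mono[OF abs_ge_self[of C], of "norm x"] by simp
  then show ?thesis using that[of "\<bar>C\<bar>"] by simp
qed

lemma bounded_opsI:
  assumes "T \<in> extensional K" "\<And>x. x \<in> K \<Longrightarrow> T x \<in> K"
    "\<And>x y. x \<in> K \<Longrightarrow> y \<in> K \<Longrightarrow> T (x + y) = T x + T y"
    "\<And>c x. x \<in> K \<Longrightarrow> T (scaleC c x) = scaleC c (T x)"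
    "\<And>x. x \<in> K \<Longrightarrow> norm (T x) \<le> C * norm x"
  shows "T \<in> bounded_ops K"
  unfolding bounded_ops_def using assms by blast

lemma compose_bounded_ops:
  assumes K: "hilbert_space K" and S: "S \<in> bounded_ops K" and T: "T \<in> bounded_ops K"
  shows "compose K S T \<in> bounded_ops K"
proof -
  obtain C D where C: "0 \<le> C" "\<And>x. x \<in> K \<Longrightarrow> norm (S x) \<le> C * norm x"
    and D: "0 \<le> D" "\<And>x. x \<in> K \<Longrightarrow> norm (T x) \<le> D * norm x"
    using bounded_ops_bound S T by metis
  have "norm (S (T x)) \<le> C * D * norm x" if "x \<in> K" for x
    using C(2)[of "T x"] mult_left_mono[OF D(2)[OF that] C(1)] bounded_opsD(1)[OF T that]
    by (simp add: mult.assoc)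
  then show ?thesis
    using bounded_opsD[OF S] bounded_opsD[OF T] hilbert_space_mem[OF K]
    by (intro bounded_opsI[where C = "C * D"]) (auto simp: compose_def)
qed

lemma lincomb_bounded_ops:
  assumes K: "hilbert_space K" and S: "S \<in> bounded_ops K" and T: "T \<in> bounded_ops K"
  shows "(\<lambda>x\<in>K. s *\<^sub>R S x + t *\<^sub>R T x) \<in> bounded_ops K"
proof -
  obtain C D where C: "0 \<le> C" "\<And>x. x \<in> K \<Longrightarrow> norm (S x) \<le> C * norm x"
    and D: "0 \<le> D" "\<And>x. x \<in> K \<Longrightarrow> norm (T x) \<le> D * norm x"
    using bounded_ops_bound S T by metis
  have "norm (s *\<^sub>R S x + t *\<^sub>R T x) \<le> (\<bar>s\<bar> * C + \<bar>t\<bar> * D) * norm x" if "x \<in> K" for x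
  proof -
    have "norm (s *\<^sub>R S x + t *\<^sub>R T x) \<le> \<bar>s\<bar> * norm (S x) + \<bar>t\<bar> * norm (T x)"
      using norm_triangle_ineq[of "s *\<^sub>R S x" "t *\<^sub>R T x"] by simp
    also have "\<dots> \<le> \<bar>s\<bar> * (C * norm x) + \<bar>t\<bar> * (D * norm x)"
      using C D that by (intro add_mono mult_left_mono) auto
    finally show ?thesis by (simp add: algebra_simps)
  qed
  moreover have "r *\<^sub>R scaleC c u = scaleC c (r *\<^sub>R u)" for r c and u :: 'a
    by (simp add: scaleR_scaleC scaleC_scaleC mult.commute)
  ultimately show ?thesis
    by (intro bounded_opsI[where C = "\<bar>s\<bar> * C + \<bar>t\<bar> * D"])
       (simp_all add: bounded_opsD[OF S] bounded_opsD[OF T] hilbert_space_mem[OF K]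
         scaleR_add_right scaleC_add_right)
qed

text \<open>
  The image of the compact set \<open>closure (T (unit ball))\<close> under the continuous map \<open>S\<close> is compact.
\<close>

lemma compose_compact_ops:
  assumes K: "hilbert_space K" and S: "S \<in> bounded_ops K" and T: "T \<in> compact_ops K"
  shows "compose K S T \<in> compact_ops K"
proof -
  have T': "T \<in> bounded_ops K" using T by (simp add: compact_ops_def)
  let ?B = "K \<inter> cball 0 1"
  let ?C = "closure (T ` ?B)"
  have C: "compact ?C" using T by (simp add: compact_ops_def)
  have "T ` ?B \<subseteq> K" using bounded_opsD(1)[OF T'] by auto
  then have CK: "?C \<subseteq> K" using K by (simp add: hilbert_space_def closure_minimal)
  obtain M where M: "0 \<le> M" "\<And>x. x \<in> K \<Longrightarrow> norm (S x) \<le> M * norm x"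
    using bounded_ops_bound[OF S] by metis
  have "M-lipschitz_on K S"
    using M by (intro lipschitz_onI)
      (simp_all add: dist_norm hilbert_space_mem[OF K] flip: bounded_ops_diff[OF S K])
  then have "continuous_on ?C S"
    using CK lipschitz_on_continuous_on lipschitz_on_subset by blast
  then have SC: "compact (S ` ?C)" using C by (rule compact_continuous_image)
  have "compose K S T ` ?B \<subseteq> S ` ?C"
    using closure_subset by (fastforce simp: compose_def)
  then have "closure (compose K S T ` ?B) \<subseteq> S ` ?C"
    using SC by (simp add: closure_minimal compact_imp_closed)
  then have "compact (closure (compose K S T ` ?B))"
    using compact_Int_closed[OF SC closed_closure] by (metis inf.absorb2)
  then show ?thesis using compose_bounded_ops[OF K S T'] by (simp add: compact_ops_def)
qed

section \<open>Representations and approximate units\<close>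

lemma geometric_increments_converge:
  fixes f :: "nat \<Rightarrow> 'b::banach"
  assumes q: "0 \<le> q" "q < 1" and f: "\<And>n. norm (f (Suc n) - f n) \<le> M * q ^ n"
  obtains l where "f \<longlonglongrightarrow> l" "norm (l - f 0) \<le> M / (1 - q)"
proof -
  have s: "(\<lambda>n. M * q ^ n) sums (M / (1 - q))"
    using sums_mult[OF geometric_sums[of q], of M] q by simp
  have sn: "summable (\<lambda>n. norm (f (Suc n) - f n))"
    using f by (intro summable_comparison_test'[OF sums_summable[OF s]]) simp
  then have sd: "summable (\<lambda>n. f (Suc n) - f n)" by (rule summable_norm_cancel)
  let ?s = "\<Sum>n. f (Suc n) - f n"
  have "(\<lambda>n. f n - f 0) \<longlonglongrightarrow> ?s"
    using summable_LIMSEQ[OF sd] by (simp add: sum_lessThan_telescope)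
  then have "(\<lambda>n. f n - f 0 + f 0) \<longlonglongrightarrow> ?s + f 0" by (intro tendsto_add tendsto_const)
  moreover have "norm ?s \<le> (\<Sum>n. norm (f (Suc n) - f n))" by (rule summable_norm[OF sn])
  moreover have "\<dots> \<le> (\<Sum>n. M * q ^ n)" by (rule suminf_le[OF f sn sums_summable[OF s]])
  ultimately show ?thesis using that[of "?s + f 0"] sums_unique[OF s] by simp
qed

locale representation =
  fixes K :: "'h::complex_hilbert_space set" and \<rho> :: "'l::cstar_algebra \<Rightarrow> 'h \<Rightarrow> 'h"
  assumes K: "hilbert_space K" and rep: "is_representation K \<rho>"
begin

lemma rho_bounded_ops: "\<rho> a \<in> bounded_ops K"
  using rep by (simp add: is_representation_def)

lemmas mem = hilbert_space_mem[OF K]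
lemmas rho_mem = bounded_opsD(1)[OF rho_bounded_ops]
lemmas rho_vec_add = bounded_opsD(2)[OF rho_bounded_ops]
lemmas rho_vec_scaleC = bounded_opsD(3)[OF rho_bounded_ops]
lemmas rho_vec_scaleR = bounded_opsD(4)[OF rho_bounded_ops]
lemmas rho_vec_diff = bounded_ops_diff[OF rho_bounded_ops K]

lemma rho_add: "x \<in> K \<Longrightarrow> \<rho> (a + b) x = \<rho> a x + \<rho> b x"
  using rep by (simp add: is_representation_def)

lemma rho_diff: "x \<in> K \<Longrightarrow> \<rho> (a - b) x = \<rho> a x - \<rho> b x"
  using rho_add[of x "a - b" b] by simp

lemma rho_scaleR: "x \<in> K \<Longrightarrow> \<rho> (r *\<^sub>R a) x = r *\<^sub>R \<rho> a x"
  using rep by (simp add: is_representation_def scaleR_scaleC)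

lemma rho_mult: "x \<in> K \<Longrightarrow> \<rho> (a * b) x = \<rho> a (\<rho> b x)"
  using rep by (simp add: is_representation_def compose_def)

lemma rho_adjoint: "x \<in> K \<Longrightarrow> y \<in> K \<Longrightarrow> cinner (\<rho> a x) y = cinner x (\<rho> (star a) y)"
  using rep by (simp add: is_representation_def is_adjoint_def)

text \<open>
  Star-representations are automatically contractive.  If \<open>1 - a\<^sup>* a = (1 - y)\<^sup>2\<close> with \<open>y\<close> selfadjoint,
  then \<open>\<parallel>x\<parallel>\<^sup>2 - \<parallel>\<rho>(a) x\<parallel>\<^sup>2 = \<parallel>x - \<rho>(y) x\<parallel>\<^sup>2\<close>, which is nonnegative.
\<close>

lemma norm_rho_le_if_norm_less_one:
  assumes a: "norm a < 1" and x: "x \<in> K"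
  shows "norm (\<rho> a x) \<le> norm x"
proof -
  have h: "star (star a * a) = star a * a" "norm (star a * a) < 1"
    using a by (simp_all add: star_mult star_star cstar_identity abs_square_less_1)
  obtain y where y: "star y = y" "star a * a = 2 *\<^sub>R y - y * y"
    using ex_sqrt_one_minus[OF h] by blast
  have "cinner (\<rho> a x) (\<rho> a x) = cinner x (\<rho> (star a * a) x)"
    using x by (simp add: rho_adjoint rho_mult rho_mem)
  also have "\<rho> (star a * a) x = \<rho> y x + \<rho> y x - \<rho> y (\<rho> y x)"
    using x by (simp add: y(2) rho_add rho_diff rho_mult scaleR_2)
  finally have "cinner (\<rho> a x) (\<rho> a x) = cinner x x - cinner (x - \<rho> y x) (x - \<rho> y x)"
    using x rho_adjoint[of x x y] rho_adjoint[of x "\<rho> y x" y]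
    by (simp add: y(1) cinner_diff_left cinner_diff_right cinner_add_right rho_mem)
  then have "complex_of_real ((norm (\<rho> a x))\<^sup>2) = complex_of_real ((norm x)\<^sup>2 - (norm (x - \<rho> y x))\<^sup>2)"
    by (simp add: cinner_self)
  then have "(norm (\<rho> a x))\<^sup>2 = (norm x)\<^sup>2 - (norm (x - \<rho> y x))\<^sup>2"
    by (simp only: of_real_eq_iff)
  then have "(norm (\<rho> a x))\<^sup>2 \<le> (norm x)\<^sup>2" by simp
  then show ?thesis by (simp add: power2_le_iff_abs_le)
qed

lemma norm_rho_le:
  assumes x: "x \<in> K"
  shows "norm (\<rho> a x) \<le> norm a * norm x"
proof -
  have *: "norm (\<rho> a x) \<le> r * norm x" if r: "norm a < r" for r
  proof -
    have r0: "0 < r" using r norm_ge_zero[of a] by linarith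
    then have "norm (\<rho> ((1 / r) *\<^sub>R a) x) \<le> norm x"
      using r by (intro norm_rho_le_if_norm_less_one x) (simp add: divide_simps)
    then show ?thesis using r0 x by (simp add: rho_scaleR divide_simps mult.commute)
  qed
  show ?thesis
  proof (rule tendsto_lowerbound)
    show "((\<lambda>r. r * norm x) \<longlongrightarrow> norm a * norm x) (at_right (norm a))"
      by (intro tendsto_intros)
    show "\<forall>\<^sub>F r in at_right (norm a). norm (\<rho> a x) \<le> r * norm x"
      using * by (auto simp: eventually_at_filter)
  qed simp
qed

lemma tendsto_rho:
  assumes p: "(p \<longlongrightarrow> a) F" and v: "(v \<longlongrightarrow> x) F" and vK: "\<And>i. v i \<in> K" "x \<in> K"
  shows "((\<lambda>i. \<rho> (p i) (v i)) \<longlongrightarrow> \<rho> a x) F"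
proof -
  have bound: "norm (\<rho> (p i) (v i) - \<rho> a x) \<le> norm (p i - a) * norm (v i) + norm a * norm (v i - x)" for i
  proof -
    have "\<rho> (p i) (v i) - \<rho> a x = \<rho> (p i - a) (v i) + \<rho> a (v i - x)"
      using vK by (simp add: rho_diff rho_vec_diff)
    also have "norm \<dots> \<le> norm (p i - a) * norm (v i) + norm a * norm (v i - x)"
      using vK by (intro norm_triangle_mono norm_rho_le mem)
    finally show ?thesis .
  qed
  have "((\<lambda>i. norm (p i - a) * norm (v i) + norm a * norm (v i - x)) \<longlongrightarrow> 0 * norm x + norm a * 0) F"
    using LIM_zero[OF p] LIM_zero[OF v] by (intro tendsto_intros tendsto_norm_zero v)
  then have "((\<lambda>i. norm (p i - a) * norm (v i) + norm a * norm (v i - x)) \<longlongrightarrow> 0) F" by simp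
  then have "((\<lambda>i. \<rho> (p i) (v i) - \<rho> a x) \<longlongrightarrow> 0) F"
    by (rule Lim_null_comparison[OF always_eventually[OF allI[OF bound]]])
  then show ?thesis by (rule LIM_zero_cancel)
qed

lemma norm_complement_rho_le:
  assumes "nonexpansive_complement e" "x \<in> K"
  shows "norm (x - \<rho> e x) \<le> 3 * norm x"
proof -
  have "norm (\<rho> e x) \<le> 2 * norm x"
    using norm_rho_le[OF assms(2), of e] norm_le_2_if_nonexpansive_complement[OF assms(1)]
      mult_right_mono[of "norm e" 2 "norm x"] by simp
  then show ?thesis using norm_triangle_ineq4[of x "\<rho> e x"] by simp
qed

text \<open>
  Convergence is clear on the vectors \<open>\<rho>(a) x\<close>, hence on their linear span, which is dense by
  non-degeneracy; the operators \<open>1 - \<rho>(e)\<close> are uniformly bounded, so it passes to the closure.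
\<close>

lemma tendsto_approx_unit_vector:
  assumes nd: "nondegenerate K \<rho>" and v: "v \<in> K"
  shows "((\<lambda>e. \<rho> e v) \<longlongrightarrow> v) approx_unit_filter"
proof -
  let ?S = "{\<rho> a x | a x. x \<in> K}"
  \<comment> \<open>Vectors of the span lie in \<open>K\<close>, where \<open>\<rho> e\<close> is linear; elsewhere it is \<open>undefined\<close>.\<close>
  have SK: "complex_vector.span ?S \<subseteq> K"
    using K by (intro complex_vector.span_minimal) (auto simp: rho_mem hilbert_space_def)
  have span: "((\<lambda>e. \<rho> e w) \<longlongrightarrow> w) approx_unit_filter" if w: "w \<in> complex_vector.span ?S" for w
  proof -
    have "w \<in> K \<and> ((\<lambda>e. \<rho> e w) \<longlongrightarrow> w) approx_unit_filter"
      using w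
    proof (induction rule: complex_vector.span_induct_alt)
      case base
      have "\<rho> e 0 = 0" for e using rho_vec_scaleR[of 0 e 0] by (simp add: mem)
      then show ?case by (simp add: mem)
    next
      case (step c u w)
      then obtain a x where u: "u = \<rho> a x" "x \<in> K" by blast
      have "((\<lambda>e. \<rho> (e * a) x) \<longlongrightarrow> \<rho> a x) approx_unit_filter"
        using u by (intro tendsto_rho tendsto_approx_unit_left tendsto_const)
      then have "((\<lambda>e. scaleC c (\<rho> e u) + \<rho> e w) \<longlongrightarrow> scaleC c u + w) approx_unit_filter"
        using step u by (intro tendsto_add tendsto_scaleC) (simp_all add: rho_mult)
      then show ?case
        using step u by (simp add: mem rho_mem rho_vec_add rho_vec_scaleC)
    qed
    then show ?thesis by simp
  qed
  show ?thesis
    unfolding tendsto_iff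
  proof safe
    fix \<epsilon> :: real assume \<epsilon>: "0 < \<epsilon>"
    have "v \<in> closure (complex_vector.span ?S)" using nd v by (simp add: nondegenerate_def)
    then have "\<exists>w\<in>complex_vector.span ?S. dist w v < \<epsilon> / 4"
      using \<epsilon> by (intro closure_approachable[THEN iffD1, rule_format]) simp_all
    then obtain w where w: "w \<in> complex_vector.span ?S" "norm (w - v) < \<epsilon> / 4"
      by (auto simp only: dist_norm)
    have "eventually (\<lambda>e. dist (\<rho> e w) w < \<epsilon> / 4) approx_unit_filter"
      using tendstoD[OF span[OF w(1)], of "\<epsilon> / 4"] \<epsilon> by simp
    with eventually_approx_unit
    show "eventually (\<lambda>e. dist (\<rho> e v) v < \<epsilon>) approx_unit_filter"
    proof eventually_elim
      case (elim e)
      have wK: "w \<in> K" using w SK by blast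
      then have "\<rho> e v - v = (\<rho> e w - w) + ((w - v) - \<rho> e (w - v))"
        using v by (simp add: rho_vec_diff)
      then have "norm (\<rho> e v - v) \<le> norm (\<rho> e w - w) + norm ((w - v) - \<rho> e (w - v))"
        by (simp only: norm_triangle_ineq)
      also have "\<dots> < \<epsilon> / 4 + 3 * (\<epsilon> / 4)"
        using elim w(2) norm_complement_rho_le[of e "w - v"] wK v
        by (intro add_less_le_mono) (auto simp: dist_norm mem)
      finally show ?case by (simp add: dist_norm)
    qed
  qed
qed

text \<open>
  \<open>\<rho>(e) T\<close> converges to \<open>T\<close> in operator norm along the approximate identity.
\<close>

definition approx_unit_fixes :: "('h \<Rightarrow> 'h) \<Rightarrow> bool" where
  "approx_unit_fixes T \<longleftrightarrow>
    (\<forall>\<epsilon>>0. \<forall>\<^sub>F e in approx_unit_filter. \<forall>x\<in>K. norm (T x - \<rho> e (T x)) \<le> \<epsilon> * norm x)"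

text \<open>
  Strong convergence of uniformly bounded operators is uniform on totally bounded sets, and a
  compact \<open>T\<close> maps the unit ball to such a set.
\<close>

lemma approx_unit_fixes_compact:
  assumes nd: "nondegenerate K \<rho>" and T: "T \<in> compact_ops K"
  shows "approx_unit_fixes T"
  unfolding approx_unit_fixes_def
proof (intro allI impI)
  fix \<epsilon> :: real assume \<epsilon>: "0 < \<epsilon>"
  have T': "T \<in> bounded_ops K" using T by (simp add: compact_ops_def)
  let ?C = "closure (T ` (K \<inter> cball 0 1))"
  have C: "compact ?C" using T by (simp add: compact_ops_def)
  have "T ` (K \<inter> cball 0 1) \<subseteq> K" using bounded_opsD(1)[OF T'] by auto
  then have CK: "?C \<subseteq> K" using K by (simp add: hilbert_space_def closure_minimal)
  have "?C \<subseteq> (\<Union>v\<in>?C. ball v (\<epsilon> / 4))" using \<epsilon> by force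
  then obtain D where D: "D \<subseteq> ?C" "finite D" "?C \<subseteq> (\<Union>v\<in>D. ball v (\<epsilon> / 4))"
    using compactE_image[OF C, of ?C "\<lambda>v. ball v (\<epsilon> / 4)"] by blast
  have "eventually (\<lambda>e. dist (\<rho> e v) v < \<epsilon> / 4) approx_unit_filter" if "v \<in> D" for v
  proof (rule tendstoD)
    show "((\<lambda>e. \<rho> e v) \<longlongrightarrow> v) approx_unit_filter"
      using that D(1) CK by (intro tendsto_approx_unit_vector[OF nd]) blast
  qed (use \<epsilon> in simp)
  then have "\<forall>\<^sub>F e in approx_unit_filter. \<forall>v\<in>D. dist (\<rho> e v) v < \<epsilon> / 4"
    using D(2) by (simp add: eventually_ball_finite)
  with eventually_approx_unit
  show "\<forall>\<^sub>F e in approx_unit_filter. \<forall>x\<in>K. norm (T x - \<rho> e (T x)) \<le> \<epsilon> * norm x"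
  proof eventually_elim
    case (elim e)
    have unit: "norm (T x - \<rho> e (T x)) \<le> \<epsilon>" if x: "x \<in> K" "norm x \<le> 1" for x
    proof -
      have "T x \<in> ?C" using x by (intro subsetD[OF closure_subset] imageI) auto
      then obtain v where v: "v \<in> D" "norm (v - T x) < \<epsilon> / 4" using D(3) by (auto simp: dist_norm)
      have vK: "v \<in> K" and TK: "T x \<in> K" using v(1) D(1) CK x bounded_opsD(1)[OF T'] by auto
      have "T x - \<rho> e (T x) = ((T x - v) - \<rho> e (T x - v)) + (v - \<rho> e v)"
        using vK TK by (simp add: rho_vec_diff)
      then have "norm (T x - \<rho> e (T x)) \<le> norm ((T x - v) - \<rho> e (T x - v)) + norm (v - \<rho> e v)"
        by (simp only: norm_triangle_ineq)
      also have "\<dots> \<le> 3 * (\<epsilon> / 4) + \<epsilon> / 4"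
        using elim v norm_complement_rho_le[of e "T x - v"] vK TK
        by (intro add_mono) (auto simp: dist_norm mem norm_minus_commute)
      finally show ?thesis by simp
    qed
    show ?case
    proof
      fix x assume x: "x \<in> K"
      show "norm (T x - \<rho> e (T x)) \<le> \<epsilon> * norm x"
      proof (cases "x = 0")
        case True
        have "T 0 = 0" "\<rho> e 0 = 0"
          using bounded_opsD(4)[OF T', of 0 0] rho_vec_scaleR[of 0 e 0] by (simp_all add: mem)
        with True show ?thesis by simp
      next
        case False
        define y where "y = (1 / norm x) *\<^sub>R x"
        have y: "y \<in> K" "norm y \<le> 1" "x = norm x *\<^sub>R y" using x False by (simp_all add: y_def mem)
        have "T (norm x *\<^sub>R y) = norm x *\<^sub>R T y" by (rule bounded_opsD(4)[OF T' y(1)])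
        then have "T x = norm x *\<^sub>R T y" by (simp only: y(3)[symmetric])
        then have "T x - \<rho> e (T x) = norm x *\<^sub>R (T y - \<rho> e (T y))"
          by (simp add: bounded_opsD(1)[OF T' y(1)] rho_vec_scaleR scaleR_diff_right)
        then show ?thesis using mult_left_mono[OF unit[OF y(1,2)] norm_ge_zero[of x]]
          by (simp add: mult.commute)
      qed
    qed
  qed
qed

lemma approx_unit_fixes_compose_rho:
  assumes V: "V \<in> bounded_ops K"
  shows "approx_unit_fixes (compose K (\<rho> a) V)"
  unfolding approx_unit_fixes_def
proof (intro allI impI)
  fix \<epsilon> :: real assume \<epsilon>: "0 < \<epsilon>"
  obtain C where C: "0 \<le> C" "\<And>x. x \<in> K \<Longrightarrow> norm (V x) \<le> C * norm x"
    using bounded_ops_bound[OF V] by metis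
  have "eventually (\<lambda>e. dist (e * a) a < \<epsilon> / (C + 1)) approx_unit_filter"
    using tendsto_approx_unit_left[of a] \<epsilon> C(1) by (simp add: tendsto_iff)
  then show "\<forall>\<^sub>F e in approx_unit_filter. \<forall>x\<in>K.
      norm (compose K (\<rho> a) V x - \<rho> e (compose K (\<rho> a) V x)) \<le> \<epsilon> * norm x"
  proof eventually_elim
    case (elim e)
    show ?case
    proof
      fix x assume x: "x \<in> K"
      note Vx = bounded_opsD(1)[OF V x]
      have VC: "norm (V x) \<le> (C + 1) * norm x"
        using C(2)[OF x] norm_ge_zero[of x] unfolding distrib_right mult_1 by linarith
      have "norm (\<rho> (a - e * a) (V x)) \<le> norm (a - e * a) * ((C + 1) * norm x)"
        using norm_rho_le[OF Vx] mult_left_mono[OF VC norm_ge_zero] by (rule order_trans)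
      also have "\<dots> \<le> \<epsilon> / (C + 1) * ((C + 1) * norm x)"
        using elim C(1) by (intro mult_right_mono) (auto simp: dist_norm norm_minus_commute)
      also have "\<dots> = \<epsilon> * norm x" using C(1) by simp
      finally show "norm (compose K (\<rho> a) V x - \<rho> e (compose K (\<rho> a) V x)) \<le> \<epsilon> * norm x"
        using x Vx by (simp add: compose_def rho_diff rho_mult)
    qed
  qed
qed

lemma approx_unit_fixes_lincomb:
  assumes V: "V \<in> bounded_ops K" "approx_unit_fixes V" and W: "W \<in> bounded_ops K" "approx_unit_fixes W"
  shows "approx_unit_fixes (\<lambda>x\<in>K. s *\<^sub>R V x + t *\<^sub>R W x)"
  unfolding approx_unit_fixes_def
proof (intro allI impI)
  fix \<epsilon> :: real assume \<epsilon>: "0 < \<epsilon>"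
  define \<delta> where "\<delta> = \<epsilon> / (\<bar>s\<bar> + \<bar>t\<bar> + 1)"
  have \<delta>: "0 < \<delta>" "(\<bar>s\<bar> + \<bar>t\<bar>) * \<delta> \<le> \<epsilon>" using \<epsilon> by (simp_all add: \<delta>_def field_simps)
  have "\<forall>\<^sub>F e in approx_unit_filter. \<forall>x\<in>K. norm (V x - \<rho> e (V x)) \<le> \<delta> * norm x"
    "\<forall>\<^sub>F e in approx_unit_filter. \<forall>x\<in>K. norm (W x - \<rho> e (W x)) \<le> \<delta> * norm x"
    using V W \<delta>(1) by (auto simp: approx_unit_fixes_def)
  then show "\<forall>\<^sub>F e in approx_unit_filter. \<forall>x\<in>K. norm ((\<lambda>x\<in>K. s *\<^sub>R V x + t *\<^sub>R W x) x
      - \<rho> e ((\<lambda>x\<in>K. s *\<^sub>R V x + t *\<^sub>R W x) x)) \<le> \<epsilon> * norm x"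
  proof eventually_elim
    case (elim e)
    show ?case
    proof
      fix x assume x: "x \<in> K"
      note Vx = bounded_opsD(1)[OF V(1) x] bounded_opsD(1)[OF W(1) x]
      let ?v = "V x - \<rho> e (V x)" and ?w = "W x - \<rho> e (W x)"
      have "norm (s *\<^sub>R ?v + t *\<^sub>R ?w) \<le> \<bar>s\<bar> * norm ?v + \<bar>t\<bar> * norm ?w"
        using norm_triangle_ineq[of "s *\<^sub>R ?v" "t *\<^sub>R ?w"] by simp
      also have "\<dots> \<le> \<bar>s\<bar> * (\<delta> * norm x) + \<bar>t\<bar> * (\<delta> * norm x)"
        using elim x by (intro add_mono mult_left_mono) auto
      also have "\<dots> = ((\<bar>s\<bar> + \<bar>t\<bar>) * \<delta>) * norm x" by (simp add: algebra_simps)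
      also have "\<dots> \<le> \<epsilon> * norm x" using \<delta>(2) by (rule mult_right_mono) simp
      finally have "norm (s *\<^sub>R ?v + t *\<^sub>R ?w) \<le> \<epsilon> * norm x" .
      moreover have "\<rho> e (s *\<^sub>R V x + t *\<^sub>R W x) = s *\<^sub>R \<rho> e (V x) + t *\<^sub>R \<rho> e (W x)"
        using Vx by (simp only: rho_vec_add rho_vec_scaleR mem)
      then have "(s *\<^sub>R V x + t *\<^sub>R W x) - \<rho> e (s *\<^sub>R V x + t *\<^sub>R W x) = s *\<^sub>R ?v + t *\<^sub>R ?w"
        by (simp only: scaleR_diff_right add_diff_add)
      ultimately show "norm ((\<lambda>x\<in>K. s *\<^sub>R V x + t *\<^sub>R W x) x
          - \<rho> e ((\<lambda>x\<in>K. s *\<^sub>R V x + t *\<^sub>R W x) x)) \<le> \<epsilon> * norm x"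
        using x by (simp only: restrict_apply if_True)
    qed
  qed
qed

section \<open>Cohen factorization\<close>

text \<open>
  One step of Cohen's construction.  Write \<open>c + p\<close> for the element of the unitization with scalar
  part \<open>c\<close>.  For an approximate unit \<open>e\<close> let \<open>w = (3 - e) / 2 = (3/2) (1 - e/3)\<close>; as
  \<open>\<parallel>e/3\<parallel> \<le> 2/3\<close>, it is invertible with inverse \<open>(2/3) (1 + y)\<close>.  The operator \<open>(c + p) V\<close> is
  unchanged when \<open>V\<close> is replaced by \<open>V' = w V\<close> and \<open>c + p\<close> by \<open>c' + p' = (c + p) w\<^sup>-\<^sup>1\<close>, whose scalar
  part \<open>c'\<close> is \<open>(2/3) c\<close>.  Both changes are small because \<open>e\<close> nearly fixes \<open>V\<close> from the left and \<open>p\<close>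
  from the right, and the scalar part contributes only a multiple of \<open>c\<close>.
\<close>

lemma cohen_step:
  assumes V: "V \<in> bounded_ops K" "approx_unit_fixes V" and c: "0 < c"
  shows "\<exists>p' V'. V' \<in> bounded_ops K \<and> approx_unit_fixes V' \<and>
    (\<forall>x\<in>K. (2/3 * c) *\<^sub>R V' x + \<rho> p' (V' x) = c *\<^sub>R V x + \<rho> p (V x)) \<and>
    norm (p' - p) \<le> 3 * c \<and> (\<forall>x\<in>K. norm (V' x - V x) \<le> c * norm x)"
proof -
  have ev: "\<forall>\<^sub>F e in approx_unit_filter. (star e = e \<and> nonexpansive_complement e) \<and>
      dist (p * e) p < c \<and> (\<forall>x\<in>K. norm (V x - \<rho> e (V x)) \<le> c * norm x)"
    using V(2) c tendstoD[OF tendsto_approx_unit_right[of p] c]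
    by (intro eventually_conj eventually_approx_unit) (auto simp: approx_unit_fixes_def)
  then obtain e where e: "nonexpansive_complement e" "norm (p - p * e) < c"
      "\<And>x. x \<in> K \<Longrightarrow> norm (V x - \<rho> e (V x)) \<le> c * norm x"
    using eventually_happens'[OF approx_unit_filter_nontrivial ev]
    by (auto simp: dist_norm norm_minus_commute)
  define a where "a = (1/3) *\<^sub>R e"
  have a: "norm a \<le> 2/3"
    using norm_le_2_if_nonexpansive_complement[OF e(1)] by (simp add: a_def)
  obtain y where y: "y = a + a * y" "y = a + y * a" "(1 - norm a) * norm y \<le> norm a"
    using ex_quasi_inverse[of a] a by auto
  have "(1/3) * norm y \<le> (1 - norm a) * norm y" using a by (intro mult_right_mono) auto
  then have ny: "norm y \<le> 2" using a y(3) by linarith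
  have ey: "e * y = 3 *\<^sub>R y - e"
    using arg_cong[OF y(1), of "\<lambda>z. 3 *\<^sub>R z"] by (simp add: a_def scaleR_add_right)
  have ye: "y * e = 3 *\<^sub>R y - e"
    using arg_cong[OF y(2), of "\<lambda>z. 3 *\<^sub>R z"] by (simp add: a_def scaleR_add_right)
  define V' where "V' = (\<lambda>x\<in>K. (3/2) *\<^sub>R V x + (-1/2) *\<^sub>R compose K (\<rho> e) V x)"
  \<comment> \<open>Expanding \<open>(c + p) (2/3) (1 + y)\<close> and dropping the scalar part \<open>(2/3) c\<close>.\<close>
  define p' where "p' = (2/3) *\<^sub>R (p + p * y + c *\<^sub>R y)"
  have eV: "compose K (\<rho> e) V \<in> bounded_ops K" "approx_unit_fixes (compose K (\<rho> e) V)"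
    using V(1) by (simp_all add: compose_bounded_ops[OF K rho_bounded_ops] approx_unit_fixes_compose_rho)
  have V'x: "V' x = (3/2) *\<^sub>R V x - (1/2) *\<^sub>R \<rho> e (V x)" if "x \<in> K" for x
    using that by (simp add: V'_def compose_def)
  show ?thesis
  proof (intro exI[of _ p'] exI[of _ V'] conjI ballI)
    show "V' \<in> bounded_ops K"
      unfolding V'_def by (rule lincomb_bounded_ops[OF K V(1) eV(1)])
    show "approx_unit_fixes V'"
      unfolding V'_def by (rule approx_unit_fixes_lincomb[OF V eV])
    show "(2/3 * c) *\<^sub>R V' x + \<rho> p' (V' x) = c *\<^sub>R V x + \<rho> p (V x)" if x: "x \<in> K" for x
    proof -
      note Vx = bounded_opsD(1)[OF V(1) x]
      have "(2/3 * c) *\<^sub>R V' x + \<rho> p' (V' x) = c *\<^sub>R V x - (c/3) *\<^sub>R \<rho> e (V x)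
          + \<rho> ((3/2) *\<^sub>R p' - (1/2) *\<^sub>R (p' * e)) (V x)"
        using Vx by (simp add: V'x[OF x] rho_diff rho_scaleR rho_mult rho_vec_diff rho_vec_scaleR
            mem rho_mem scaleR_diff_right)
      also have "(3/2) *\<^sub>R p' - (1/2) *\<^sub>R (p' * e) = p + (c/3) *\<^sub>R e"
        by (simp add: p'_def distrib_right mult.assoc ye right_diff_distrib scaleR_add_right scaleR_diff_right)
      finally show ?thesis using Vx by (simp add: rho_add rho_scaleR)
    qed
    have two_thirds: "(2/3) *\<^sub>R z = z - (1/3) *\<^sub>R z" for z :: 'l
      using scaleR_left_diff_distrib[of 1 "1/3" z] by simp
    have "p' - p = (2/3 * c) *\<^sub>R y - (1/3) *\<^sub>R ((p - p * e) + (p - p * e) * y)"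
      by (simp add: p'_def left_diff_distrib mult.assoc ey right_diff_distrib scaleR_add_right scaleR_diff_right)
         (simp add: two_thirds)
    also have "norm \<dots> \<le> 2/3 * c * norm y + 1/3 * (norm (p - p * e) + norm (p - p * e) * norm y)"
      using c by (intro norm_triangle_le_diff add_mono)
       (auto intro!: norm_triangle_le add_left_mono norm_mult_ineq)
    also have "\<dots> \<le> 2/3 * c * 2 + 1/3 * (c + c * 2)"
      using c e(2) ny by (intro add_mono mult_mono) auto
    also have "\<dots> \<le> 3 * c" using c by simp
    finally show "norm (p' - p) \<le> 3 * c" .
    show "norm (V' x - V x) \<le> c * norm x" if x: "x \<in> K" for x
    proof -
      have "V' x - V x = (1/2) *\<^sub>R (V x - \<rho> e (V x))"
        using scaleR_left_distrib[of 1 "1/2" "V x"] by (simp add: V'x[OF x] scaleR_diff_right)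
      then show ?thesis using e(3)[OF x] order_trans[OF norm_ge_zero e(3)[OF x]] by simp
    qed
  qed
qed

text \<open>
  Iterate the step from \<open>T = (1 + 0) T\<close> with scalar parts \<open>(2/3)\<^sup>n\<close>.  The operators \<open>V\<^sub>n\<close> and the
  elements \<open>p\<^sub>n\<close> change by geometrically decreasing amounts and the scalar parts vanish in the
  limit, so \<open>T = ((2/3)\<^sup>n + \<rho>(p\<^sub>n)) V\<^sub>n\<close> becomes a factorization through the algebra itself.
\<close>

lemma cohen_factorization:
  assumes T: "T \<in> bounded_ops K" "approx_unit_fixes T"
  obtains p S where "S \<in> bounded_ops K" "T = compose K (\<rho> p) S"
proof -
  define q :: real where "q = 2/3"
  \<comment> \<open>The clause for \<open>n = 0\<close> anchors the sequence at \<open>T\<close>, so that the limit stays within \<open>3 \<parallel>x\<parallel>\<close> of \<open>T x\<close>.\<close>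
  let ?P = "\<lambda>n (p, V). V \<in> bounded_ops K \<and> approx_unit_fixes V \<and>
      (\<forall>x\<in>K. T x = q ^ n *\<^sub>R V x + \<rho> p (V x)) \<and> (n = 0 \<longrightarrow> V = T)"
  let ?Q = "\<lambda>n (p, V) (p', V'). norm (p' - p) \<le> 3 * q ^ n \<and>
      (\<forall>x\<in>K. norm (V' x - V x) \<le> q ^ n * norm x)"
  have "\<exists>f. \<forall>n. ?P n (f n) \<and> ?Q n (f n) (f (Suc n))"
  proof (rule dependent_nat_choice)
    have "\<rho> 0 x = 0" if "x \<in> K" for x using rho_diff[OF that, of 0 0] by simp
    then show "\<exists>z. ?P 0 z" using T bounded_opsD(1)[OF T(1)]
      by (intro exI[of _ "(0, T)"]) simp
  next
    fix z n assume z: "?P n z"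
    obtain p V where pV: "z = (p, V)" by force
    have V: "V \<in> bounded_ops K" "approx_unit_fixes V"
      and Tx: "\<And>x. x \<in> K \<Longrightarrow> T x = q ^ n *\<^sub>R V x + \<rho> p (V x)"
      using z by (auto simp: pV)
    have "0 < q ^ n" by (simp add: q_def)
    obtain p' V' where V': "V' \<in> bounded_ops K" "approx_unit_fixes V'"
        "\<forall>x\<in>K. (2/3 * q ^ n) *\<^sub>R V' x + \<rho> p' (V' x) = q ^ n *\<^sub>R V x + \<rho> p (V x)"
        "norm (p' - p) \<le> 3 * q ^ n" "\<forall>x\<in>K. norm (V' x - V x) \<le> q ^ n * norm x"
      using cohen_step[OF V \<open>0 < q ^ n\<close>, of p] by (elim exE conjE)
    have "2/3 * q ^ n = q ^ Suc n" by (simp add: q_def)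
    then have "T x = q ^ Suc n *\<^sub>R V' x + \<rho> p' (V' x)" if "x \<in> K" for x
      using bspec[OF V'(3) that] Tx[OF that] by (simp only:)
    with V'(1,2,4,5) have "?P (Suc n) (p', V') \<and> ?Q n z (p', V')"
      unfolding pV prod.case by blast
    then show "\<exists>z'. ?P (Suc n) z' \<and> ?Q n z z'" by blast
  qed
  then obtain f where f: "\<forall>n. ?P n (f n) \<and> ?Q n (f n) (f (Suc n))" by (rule exE)
  define p where "p n = fst (f n)" for n
  define V where "V n = snd (f n)" for n
  have V: "V n \<in> bounded_ops K" and Tx: "x \<in> K \<Longrightarrow> T x = q ^ n *\<^sub>R V n x + \<rho> (p n) (V n x)"
    and dp: "norm (p (Suc n) - p n) \<le> 3 * q ^ n"
    and dV: "x \<in> K \<Longrightarrow> norm (V (Suc n) x - V n x) \<le> norm x * q ^ n" and V0: "V 0 = T" for n x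
    using spec[OF f, of n] spec[OF f, of 0] by (auto simp: p_def V_def split_beta mult.commute)
  have q: "0 \<le> q" "q < 1" by (simp_all add: q_def)
  obtain r where r: "p \<longlonglongrightarrow> r"
    using geometric_increments_converge[OF q dp] by blast
  define S0 where "S0 x = lim (\<lambda>n. V n x)" for x
  have S0: "(\<lambda>n. V n x) \<longlonglongrightarrow> S0 x" "norm (S0 x - T x) \<le> 3 * norm x" if x: "x \<in> K" for x
  proof -
    obtain l where l: "(\<lambda>n. V n x) \<longlonglongrightarrow> l" "norm (l - V 0 x) \<le> norm x / (1 - q)"
      using geometric_increments_converge[OF q dV[OF x]] by blast
    moreover have "S0 x = l" using l(1) by (simp add: S0_def limI)
    ultimately show "(\<lambda>n. V n x) \<longlonglongrightarrow> S0 x" "norm (S0 x - T x) \<le> 3 * norm x"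
      by (simp_all add: V0 q_def)
  qed
  have S0K: "S0 x \<in> K" if "x \<in> K" for x
  proof (rule closed_sequentially[OF _ _ S0(1)[OF that]])
    show "closed K" using K by (simp add: hilbert_space_def)
  qed (rule bounded_opsD(1)[OF V that])
  obtain C where C: "0 \<le> C" "\<And>x. x \<in> K \<Longrightarrow> norm (T x) \<le> C * norm x"
    using bounded_ops_bound[OF T(1)] by metis
  define S where "S = restrict S0 K"
  have "S \<in> bounded_ops K"
  proof (rule bounded_opsI)
    show "S \<in> extensional K" by (simp add: S_def)
    show "S x \<in> K" if "x \<in> K" for x using that S0K by (simp add: S_def)
    show "S (x + y) = S x + S y" if xy: "x \<in> K" "y \<in> K" for x y
    proof -
      have "(\<lambda>n. V n (x + y)) \<longlonglongrightarrow> S0 x + S0 y"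
        using tendsto_add[OF S0(1)[OF xy(1)] S0(1)[OF xy(2)]] by (simp add: bounded_opsD(2)[OF V xy])
      then show ?thesis
        using LIMSEQ_unique[OF S0(1)[of "x + y"]] xy by (simp add: S_def mem)
    qed
    show "S (scaleC c x) = scaleC c (S x)" if x: "x \<in> K" for c x
    proof -
      have "(\<lambda>n. V n (scaleC c x)) \<longlonglongrightarrow> scaleC c (S0 x)"
        using tendsto_scaleC[OF S0(1)[OF x], of c] by (simp add: bounded_opsD(3)[OF V x])
      then show ?thesis
        using LIMSEQ_unique[OF S0(1)[of "scaleC c x"]] x by (simp add: S_def mem)
    qed
    show "norm (S x) \<le> (3 + C) * norm x" if x: "x \<in> K" for x
      using S0(2)[OF x] C(2)[OF x] norm_triangle_sub[of "S0 x" "T x"] x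
      by (simp add: S_def distrib_right)
  qed
  moreover have "T = compose K (\<rho> r) S"
  proof (rule extensionalityI[OF bounded_opsD(5)[OF T(1)]])
    show "compose K (\<rho> r) S \<in> extensional K" by simp
    fix x assume x: "x \<in> K"
    have "(\<lambda>n. q ^ n *\<^sub>R V n x) \<longlonglongrightarrow> 0 *\<^sub>R S0 x"
      using q by (intro tendsto_scaleR S0(1)[OF x] LIMSEQ_power_zero) simp
    then have "(\<lambda>n. q ^ n *\<^sub>R V n x + \<rho> (p n) (V n x)) \<longlonglongrightarrow> 0 *\<^sub>R S0 x + \<rho> r (S0 x)"
      using x by (intro tendsto_add tendsto_rho r S0(1)) (simp_all add: S0K bounded_opsD(1)[OF V])
    then have "(\<lambda>n. T x) \<longlonglongrightarrow> \<rho> r (S0 x)"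
      by (simp flip: Tx[OF x])
    then show "T x = compose K (\<rho> r) S x"
      using x LIMSEQ_unique[OF tendsto_const] by (simp add: S_def compose_def)
  qed
  ultimately show ?thesis using that by blast
qed

end

section \<open>Cross representations\<close>

lemma host_rep_mem_Reps:
  assumes "U \<in> L_representations K \<eta>"
  shows "host_rep K \<eta> U \<in> Reps K"
  using assms by (simp add: host_rep_def L_representations_def inv_into_into)

text \<open>
  The cross condition asks that each \<open>\<pi>(A) U\<^sub>L(L)\<close> factor through \<open>U\<^sub>L\<close> on the left; as a compact
  operator it does, by Cohen factorization for the non-degenerate representation \<open>U\<^sub>L\<close>.
\<close>

lemma cross_representation_if_compact:
  assumes K: "hilbert_space K" and cov: "(\<pi>, U) \<in> covariant_L_Reps K \<alpha> \<eta>"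
    and cpt: "op_set_prod K (range \<pi>) (range (host_rep K \<eta> U)) \<subseteq> compact_ops K"
  shows "cross_representation K \<alpha> \<eta> \<pi> U"
  unfolding cross_representation_def
proof (intro conjI cov subsetI)
  have "host_rep K \<eta> U \<in> Reps K"
    using cov by (intro host_rep_mem_Reps) (simp add: covariant_L_Reps_def)
  then have nd: "nondegenerate K (host_rep K \<eta> U)" and "representation K (host_rep K \<eta> U)"
    using K by (simp_all add: Reps_def representation_def)
  then interpret representation K "host_rep K \<eta> U" by simp
  fix T assume "T \<in> op_set_prod K (range \<pi>) (range (host_rep K \<eta> U))"
  then have T: "T \<in> compact_ops K" using cpt by blast
  then obtain p S where "S \<in> bounded_ops K" "T = compose K (host_rep K \<eta> U p) S"
    using cohen_factorization[OF _ approx_unit_fixes_compact[OF nd T]]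
    unfolding compact_ops_def by blast
  then show "T \<in> op_set_prod K (range (host_rep K \<eta> U)) (bounded_ops K)"
    by (auto simp: op_set_prod_def)
qed

theorem theorem6p1:
  fixes \<alpha> :: "'g::topological_group_add \<Rightarrow> 'a::cstar_algebra \<Rightarrow> 'a"
    and \<eta> :: "'g \<Rightarrow> 'l::cstar_algebra multiplier"
    and K :: "'h::complex_hilbert_space set"
    and \<pi> :: "'a \<Rightarrow> 'h \<Rightarrow> 'h"
    and U :: "'g \<Rightarrow> 'h \<Rightarrow> 'h"
  assumes "cstar_action \<alpha>"
    and "host_algebra TYPE('h) \<eta>"
    and "hilbert_space K"
    and "(\<pi>, U) \<in> covariant_L_Reps K \<alpha> \<eta>"
  shows "(op_set_prod K (range \<pi>) (range (host_rep K \<eta> U)) \<subseteq> compact_ops K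
            \<longrightarrow> cross_representation K \<alpha> \<eta> \<pi> U)
       \<and> (range (host_rep K \<eta> U) \<subseteq> compact_ops K
            \<longrightarrow> cross_representation K \<alpha> \<eta> \<pi> U)"
proof (intro conjI impI)
  note cross = cross_representation_if_compact[OF assms(3,4)]
  show "cross_representation K \<alpha> \<eta> \<pi> U"
    if "op_set_prod K (range \<pi>) (range (host_rep K \<eta> U)) \<subseteq> compact_ops K"
    using that by (rule cross)
  show "cross_representation K \<alpha> \<eta> \<pi> U" if L: "range (host_rep K \<eta> U) \<subseteq> compact_ops K"
  proof (rule cross)
    have "\<pi> a \<in> bounded_ops K" for a
      using assms(4) by (simp add: covariant_L_Reps_def Reps_def is_representation_def)
    then show "op_set_prod K (range \<pi>) (range (host_rep K \<eta> U)) \<subseteq> compact_ops K"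
      using L compose_compact_ops[OF assms(3)] by (auto simp: op_set_prod_def)
  qed
qed

end
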